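(* Consider the problem $\mathsf{GCBP}$ (defined in the context). For an instance with $n$ items and cost function $f$, let $F(j)=f(j)/j$ for $j\in\{1,\dots,n\}$, let $S=\arg\min_{j\in\{1,\dots,n\}}F(j)$, and let $k=\min S$. There is a polynomial-time algorithm that computes an optimal solution for every instance of $\mathsf{GCBP}$ with $k=2$.
   Context: Bin packing with general cost structures ($\mathsf{GCBP}$): an instance consists of a set of items $\mathsf{T}=\{1,\dots,n\}$, each item $i$ having a rational size $s_i\in[0,1]$ (zero sizes allowed), and a cost function $f:\{0,1,\dots,n\}\to\mathbb{Q}_{\ge 0}$ that is monotone non-decreasing with $f(0)=0$ and $f(1)=1$. A feasible solution is a partition of $\mathsf{T}$ into some number $k'$ (chosen by the algorithm) of subsets (bins) $\mathsf{B}_1,\dots,\mathsf{B}_{k'}$ with $\sum_{i\in\mathsf{B}_j}s_i\le 1$ for every $j$. Its cost is $\sum_{j=1}^{k'}f(|\mathsf{B}_j|)$, and the goal is to minimize the cost. The function $f$ is part of the input. *)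

theory Defs
  imports
    Complex_Main
    "HOL-Library.Disjoint_Sets"
    "HOL-Library.Log_Nat"
    "HOL-Computational_Algebra.Polynomial"
begin

section \<open>Bin packing with general cost structures\<close>

text \<open>
  The items are \<open>{1..num_items I}\<close>.  Only the values of \<open>item_size I\<close> on \<open>{1..num_items I}\<close> and of
  \<open>bin_cost I\<close> on \<open>{0..num_items I}\<close> belong to the instance.
\<close>

record gcbp =
  num_items :: nat
  item_size :: "nat \<Rightarrow> rat"
  bin_cost :: "nat \<Rightarrow> rat"

text \<open>The condition \<open>f(1) = 1\<close> presupposes that 1 is in the domain of \<open>f\<close>, hence \<open>n \<ge> 1\<close>.\<close>

definition gcbp_instance :: "gcbp \<Rightarrow> bool" where
  "gcbp_instance I \<longleftrightarrow>
     1 \<le> num_items I \<and>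
     (\<forall>i\<in>{1..num_items I}. 0 \<le> item_size I i \<and> item_size I i \<le> 1) \<and>
     (\<forall>j\<in>{0..num_items I}. 0 \<le> bin_cost I j) \<and>
     mono_on {0..num_items I} (bin_cost I) \<and>
     bin_cost I 0 = 0 \<and> bin_cost I 1 = 1"

definition feasible :: "gcbp \<Rightarrow> nat set set \<Rightarrow> bool" where
  "feasible I P \<longleftrightarrow>
     partition_on {1..num_items I} P \<and> (\<forall>B\<in>P. (\<Sum>i\<in>B. item_size I i) \<le> 1)"

definition total_cost :: "gcbp \<Rightarrow> nat set set \<Rightarrow> rat" where
  "total_cost I P = (\<Sum>B\<in>P. bin_cost I (card B))"

definition optimal :: "gcbp \<Rightarrow> nat set set \<Rightarrow> bool" where
  "optimal I P \<longleftrightarrow> is_arg_min (total_cost I) (feasible I) P"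

definition density :: "gcbp \<Rightarrow> nat \<Rightarrow> rat" where
  "density I j = bin_cost I j / of_nat j"

definition min_density_set :: "gcbp \<Rightarrow> nat set" where
  "min_density_set I = {j. is_arg_min (density I) (\<lambda>j. j \<in> {1..num_items I}) j}"

definition min_density_index :: "gcbp \<Rightarrow> nat" where
  "min_density_index I = Min (min_density_set I)"


section \<open>Random access programs with logarithmic cost\<close>

text \<open>
  The model of computation is the random access machine with instructions for addition,
  truncated subtraction, multiplication and integer division under the logarithmic cost criterion
  (as in Aho, Hopcroft and Ullman), which is polynomially related to Turing machines.  The control
  flow is structured, and the memory is split into finitely many (per program) named unbounded
  arrays of natural numbers.  Every operation is charged the bit lengths of the numbers and of the
  array indices it touches, so that neither large numbers nor large addresses come for free.
\<close>

type_synonym vname = string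
type_synonym state = "vname \<Rightarrow> nat \<Rightarrow> nat"

definition bit_length :: "nat \<Rightarrow> nat" where
  "bit_length x = max 1 (floorlog 2 x)"

datatype aexp =
    Lit nat
  | Arr vname aexp
  | Add aexp aexp
  | Sub aexp aexp
  | Mul aexp aexp
  | Div aexp aexp

datatype bexp =
    BConst bool
  | BNot bexp
  | BAnd bexp bexp
  | BLess aexp aexp

datatype com =
    Skip
  | Assign vname aexp aexp
  | Seq com com
  | Cond bexp com com
  | While bexp com

fun aval :: "aexp \<Rightarrow> state \<Rightarrow> nat" where
  "aval (Lit c) s = c"
| "aval (Arr x e) s = s x (aval e s)"
| "aval (Add a b) s = aval a s + aval b s"
| "aval (Sub a b) s = aval a s - aval b s"
| "aval (Mul a b) s = aval a s * aval b s"
| "aval (Div a b) s = aval a s div aval b s"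

fun acost :: "aexp \<Rightarrow> state \<Rightarrow> nat" where
  "acost (Lit c) s = bit_length c"
| "acost (Arr x e) s = acost e s + bit_length (aval e s) + bit_length (s x (aval e s))"
| "acost (Add a b) s = acost a s + acost b s + bit_length (aval a s) + bit_length (aval b s)"
| "acost (Sub a b) s = acost a s + acost b s + bit_length (aval a s) + bit_length (aval b s)"
| "acost (Mul a b) s = acost a s + acost b s + bit_length (aval a s) + bit_length (aval b s)"
| "acost (Div a b) s = acost a s + acost b s + bit_length (aval a s) + bit_length (aval b s)"

fun bval :: "bexp \<Rightarrow> state \<Rightarrow> bool" where
  "bval (BConst v) s = v"
| "bval (BNot b) s = (\<not> bval b s)"
| "bval (BAnd a b) s = (bval a s \<and> bval b s)"
| "bval (BLess a b) s = (aval a s < aval b s)"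

fun bcost :: "bexp \<Rightarrow> state \<Rightarrow> nat" where
  "bcost (BConst v) s = 1"
| "bcost (BNot b) s = bcost b s + 1"
| "bcost (BAnd a b) s = bcost a s + bcost b s + 1"
| "bcost (BLess a b) s = acost a s + acost b s + bit_length (aval a s) + bit_length (aval b s)"

text \<open>
  \<open>exec c s \<tau> t\<close>: started in state \<open>s\<close>, program \<open>c\<close> halts in state \<open>t\<close> after time \<open>\<tau>\<close>.
  \<open>Assign x e a\<close> stores the value of \<open>a\<close> in array \<open>x\<close> at the index given by the value of \<open>e\<close>.
\<close>

inductive exec :: "com \<Rightarrow> state \<Rightarrow> nat \<Rightarrow> state \<Rightarrow> bool" where
  Skip: "exec Skip s 1 s"
| Assign: "exec (Assign x e a) s
     (acost e s + acost a s + bit_length (aval e s) + bit_length (aval a s))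
     (s(x := (s x)(aval e s := aval a s)))"
| Seq: "exec c1 s \<tau>1 s' \<Longrightarrow> exec c2 s' \<tau>2 t \<Longrightarrow> exec (Seq c1 c2) s (\<tau>1 + \<tau>2) t"
| CondTrue: "bval b s \<Longrightarrow> exec c1 s \<tau> t \<Longrightarrow> exec (Cond b c1 c2) s (bcost b s + \<tau>) t"
| CondFalse: "\<not> bval b s \<Longrightarrow> exec c2 s \<tau> t \<Longrightarrow> exec (Cond b c1 c2) s (bcost b s + \<tau>) t"
| WhileFalse: "\<not> bval b s \<Longrightarrow> exec (While b c) s (bcost b s) s"
| WhileTrue: "bval b s \<Longrightarrow> exec c s \<tau>1 s' \<Longrightarrow> exec (While b c) s' \<tau>2 t \<Longrightarrow>
     exec (While b c) s (bcost b s + \<tau>1 + \<tau>2) t"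

inductive_cases SkipE: "exec Skip s \<tau> t"
inductive_cases AssignE: "exec (Assign x e a) s \<tau> t"
inductive_cases SeqE: "exec (Seq c1 c2) s \<tau> t"
inductive_cases CondE: "exec (Cond b c1 c2) s \<tau> t"
inductive_cases WhileE: "exec (While b c) s \<tau> t"

lemma exec_deterministic:
  "exec c s \<tau> t \<Longrightarrow> exec c s \<tau>' t' \<Longrightarrow> \<tau>' = \<tau> \<and> t' = t"
proof (induction arbitrary: \<tau>' t' rule: exec.induct)
  case (Skip s)
  then show ?case by (rule SkipE) simp
next
  case (Assign x e a s)
  then show ?case by (rule AssignE) simp
next
  case (Seq c1 s \<tau>1 s' c2 \<tau>2 t)
  from Seq.prems obtain r1 r2 u where *: "\<tau>' = r1 + r2" "exec c1 s r1 u" "exec c2 u r2 t'"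
    by (rule SeqE)
  from Seq.IH(1)[OF *(2)] Seq.IH(2) * show ?case by simp
next
  case (CondTrue b s c1 \<tau> t c2)
  from CondTrue.prems CondTrue.hyps(1) obtain r where "\<tau>' = bcost b s + r" "exec c1 s r t'"
    by (elim CondE) simp_all
  with CondTrue.IH show ?case by simp
next
  case (CondFalse b s c2 \<tau> t c1)
  from CondFalse.prems CondFalse.hyps(1) obtain r where "\<tau>' = bcost b s + r" "exec c2 s r t'"
    by (elim CondE) simp_all
  with CondFalse.IH show ?case by simp
next
  case (WhileFalse b s c)
  from WhileFalse.prems show ?case by (rule WhileE) (simp_all add: WhileFalse.hyps)
next
  case (WhileTrue b s c \<tau>1 s' \<tau>2 t)
  from WhileTrue.prems obtain r1 r2 u where
    *: "\<tau>' = bcost b s + r1 + r2" "exec c s r1 u" "exec (While b c) u r2 t'"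
    by (rule WhileE) (simp_all add: WhileTrue.hyps(1))
  from WhileTrue.IH(1)[OF *(2)] WhileTrue.IH(2) * show ?case by simp
qed


section \<open>Input, output and running time\<close>

text \<open>Nonnegative rationals are given by numerator and denominator in lowest terms.\<close>

definition rat_num :: "rat \<Rightarrow> nat" where
  "rat_num q = nat (fst (quotient_of q))"

definition rat_den :: "rat \<Rightarrow> nat" where
  "rat_den q = nat (snd (quotient_of q))"

definition rat_length :: "rat \<Rightarrow> nat" where
  "rat_length q = bit_length (rat_num q) + bit_length (rat_den q)"

definition input_length :: "gcbp \<Rightarrow> nat" where
  "input_length I = bit_length (num_items I)
     + (\<Sum>i\<in>{1..num_items I}. rat_length (item_size I i))
     + (\<Sum>j\<in>{0..num_items I}. rat_length (bin_cost I j))"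

definition input_state :: "gcbp \<Rightarrow> state" where
  "input_state I = (\<lambda>x i.
     if x = ''n'' \<and> i = 0 then num_items I
     else if x = ''s_num'' \<and> i \<in> {1..num_items I} then rat_num (item_size I i)
     else if x = ''s_den'' \<and> i \<in> {1..num_items I} then rat_den (item_size I i)
     else if x = ''f_num'' \<and> i \<in> {0..num_items I} then rat_num (bin_cost I i)
     else if x = ''f_den'' \<and> i \<in> {0..num_items I} then rat_den (bin_cost I i)
     else 0)"

text \<open>A program outputs a partition by writing a bin label for every item \<open>i\<close> to \<open>bin[i]\<close>.\<close>

definition output_partition :: "gcbp \<Rightarrow> state \<Rightarrow> nat set set" where
  "output_partition I t =
     (\<lambda>b. {i \<in> {1..num_items I}. t ''bin'' i = b}) ` (t ''bin'' ` {1..num_items I})"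

text \<open>
  \<open>c\<close> computes an optimal solution of every instance satisfying \<open>Q\<close>, in time bounded by one
  polynomial in the binary length of the input.
\<close>

definition solves_in_poly_time :: "com \<Rightarrow> (gcbp \<Rightarrow> bool) \<Rightarrow> bool" where
  "solves_in_poly_time c Q \<longleftrightarrow>
     (\<exists>p :: nat poly. \<forall>I. gcbp_instance I \<and> Q I \<longrightarrow>
        (\<exists>\<tau> t. exec c (input_state I) \<tau> t \<and> \<tau> \<le> poly p (input_length I) \<and>
               optimal I (output_partition I t)))"

end

theory Submission
  imports Defs
begin

text \<open>
  Let \<open>k = 2\<close>.  A bin with an even number of items may be split into pairs without increasing the
  cost, and two bins with an odd number (at least three) of items may be split into pairs after
  matching their smallest items, each of size at most 1/2.  Hence some optimal solution consists
  of single items, pairs, and one bin of arbitrary size.  Guess the largest item \<open>e\<close> of that bin and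
  the numbers of singles and of pairs.  By exchange arguments, the singles may be taken to be the
  largest items, after which the largest remaining item can always be paired with the largest item
  that fits; what is left joins \<open>e\<close>.  Trying all guesses and keeping the cheapest feasible packing
  gives an optimal solution.

  All sizes (costs) are multiplied by the product of their denominators to become integers.  The
  algorithm only uses loops over \<open>1..n\<close>, and each assignment lengthens the numbers in memory by at
  most a constant times the input length, so the logarithmic cost is polynomial.
\<close>

section \<open>Loop programs\<close>

text \<open>Splitting pays because \<open>F(2) \<le> F(j)\<close> says that \<open>j\<close> items
  in one bin cost at least \<open>j/2\<close> times \<open>f(2)\<close>, and two items of a feasible
  bin always fit together. Bins with one item resist this treatment: two single items may be too
  large to share a bin, so their number has to be guessed. Guesses record counts only, since the
  cost depends on nothing else; this leaves at most \<open>n\<close> cubed of them.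

  The obstacle for the greedy pairing is that its largest remaining item might belong to the large
  bin. Setting aside the largest item \<open>e\<close> of that bin removes it: any other item of the
  bin shares it with an item at least as large, hence has size at most 1/2, and may be exchanged
  into a pair.

  Nothing is claimed about a wrong guess. Its labelling is checked like any other and is kept only
  if it is feasible and cheaper, so optimality rests on a single right guess.

  On the machine side the danger is repeated squaring, which doubles lengths at every step. Lengths
  must therefore grow additively, by an amount that depends on the input alone.\<close>

definition upd :: "vname \<Rightarrow> nat \<Rightarrow> nat \<Rightarrow> state \<Rightarrow> state" where
  "upd x i v s = s(x := (s x)(i := v))"

lemma upd_same [simp]: "upd x i v s x = (s x)(i := v)"
  by (simp add: upd_def)

lemma upd_other [simp]: "y \<noteq> x \<Longrightarrow> upd x i v s y = s y"
  by (simp add: upd_def)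

text \<open>
  The body of a loop \<open>LFor v c\<close> must not write to \<open>v\<close> or to the input (see \<open>wf_prog\<close> below), so
  that the semantics can be given by a total function.
\<close>

datatype lcom =
    LSkip
  | LAssign vname aexp aexp
  | LSeq lcom lcom  (infixr \<open>;;\<close> 60)
  | LIf bexp lcom lcom
  | LFor vname lcom

text \<open>The bound of a loop is read once, whereas the compiled \<open>While\<close> rereads it;
  the two agree because well-formed bodies leave the inputs alone. The final write to
  \<open>v\<close> reproduces the counter value at which the \<open>While\<close> exits.\<close>

primrec den :: "lcom \<Rightarrow> state \<Rightarrow> state" where
  "den LSkip = (\<lambda>s. s)"
| "den (LAssign x e a) = (\<lambda>s. upd x (aval e s) (aval a s) s)"
| "den (LSeq c d) = (\<lambda>s. den d (den c s))"
| "den (LIf b c d) = (\<lambda>s. if bval b s then den c s else den d s)"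
| "den (LFor v c) = (\<lambda>s. upd v 0 (Suc (s ''n'' 0))
     (fold (\<lambda>i u. den c (upd v 0 i u)) [1..<Suc (s ''n'' 0)] s))"

abbreviation scalar :: "vname \<Rightarrow> aexp" where
  "scalar x \<equiv> Arr x (Lit 0)"

primrec compile :: "lcom \<Rightarrow> com" where
  "compile LSkip = Skip"
| "compile (LAssign x e a) = Assign x e a"
| "compile (LSeq c d) = Seq (compile c) (compile d)"
| "compile (LIf b c d) = Cond b (compile c) (compile d)"
| "compile (LFor v c) = Seq (Assign v (Lit 0) (Lit 1))
     (While (BLess (scalar v) (Add (scalar ''n'') (Lit 1)))
       (Seq (compile c) (Assign v (Lit 0) (Add (scalar v) (Lit 1)))))"

primrec assigned :: "lcom \<Rightarrow> vname set" where
  "assigned LSkip = {}"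
| "assigned (LAssign x e a) = {x}"
| "assigned (LSeq c d) = assigned c \<union> assigned d"
| "assigned (LIf b c d) = assigned c \<union> assigned d"
| "assigned (LFor v c) = insert v (assigned c)"

definition inputs :: "vname set" where
  "inputs = {''n'', ''s_num'', ''s_den'', ''f_num'', ''f_den''}"

text \<open>
  Products are only allowed with an input entry on the right, so that one assignment lengthens
  the numbers in memory by an amount that does not depend on their present length.
\<close>

fun input_entry :: "aexp \<Rightarrow> bool" where
  "input_entry (Arr x e) \<longleftrightarrow> x \<in> inputs"
| "input_entry _ \<longleftrightarrow> False"

text \<open>Truncated subtraction and division never exceed their left argument, so the right one
  may be arbitrary. The same goes for array indices: they affect the cost but not the stored
  value.\<close>

primrec slow :: "aexp \<Rightarrow> bool" where
  "slow (Lit c) \<longleftrightarrow> True"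
| "slow (Arr x e) \<longleftrightarrow> True"
| "slow (Add a b) \<longleftrightarrow> slow a \<and> slow b"
| "slow (Sub a b) \<longleftrightarrow> slow a"
| "slow (Mul a b) \<longleftrightarrow> slow a \<and> input_entry b"
| "slow (Div a b) \<longleftrightarrow> slow a"

primrec wf_prog :: "lcom \<Rightarrow> bool" where
  "wf_prog LSkip \<longleftrightarrow> True"
| "wf_prog (LAssign x e a) \<longleftrightarrow> x \<notin> inputs \<and> slow a"
| "wf_prog (LSeq c d) \<longleftrightarrow> wf_prog c \<and> wf_prog d"
| "wf_prog (LIf b c d) \<longleftrightarrow> wf_prog c \<and> wf_prog d"
| "wf_prog (LFor v c) \<longleftrightarrow> v \<notin> inputs \<and> v \<notin> assigned c \<and> wf_prog c"

lemma den_frame: "x \<notin> assigned c \<Longrightarrow> den c s x = s x"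
proof (induction c arbitrary: s)
  case (LFor v c)
  have "fold (\<lambda>i u. den c (upd v 0 i u)) xs s x = s x" for xs s
    using LFor by (induction xs arbitrary: s) auto
  with LFor show ?case by simp
qed auto

lemma assigned_inputs: "wf_prog c \<Longrightarrow> x \<in> inputs \<Longrightarrow> x \<notin> assigned c"
  by (induction c) auto

subsection \<open>Running time\<close>

definition bounded_by :: "nat \<Rightarrow> state \<Rightarrow> bool" where
  "bounded_by M s \<longleftrightarrow> (\<forall>x i. s x i < 2 ^ M)"

text \<open>Kept apart from \<open>bounded_by\<close> because the inputs are never overwritten:
  \<open>L\<close> stays fixed while the bound \<open>M\<close> for the whole memory grows.\<close>

definition inputs_bounded_by :: "nat \<Rightarrow> state \<Rightarrow> bool" where
  "inputs_bounded_by L s \<longleftrightarrow> (\<forall>x\<in>inputs. \<forall>i. s x i < 2 ^ L)"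

lemma bounded_by_mono: "bounded_by M s \<Longrightarrow> M \<le> M' \<Longrightarrow> bounded_by M' s"
  unfolding bounded_by_def by (meson less_le_trans one_le_numeral power_increasing)

lemma bounded_by_upd: "bounded_by M s \<Longrightarrow> v < 2 ^ M \<Longrightarrow> bounded_by M (upd x i v s)"
  by (simp add: bounded_by_def upd_def)

lemma inputs_bounded_by_cong:
  "inputs_bounded_by L s \<Longrightarrow> (\<And>x. x \<in> inputs \<Longrightarrow> t x = s x) \<Longrightarrow> inputs_bounded_by L t"
  by (simp add: inputs_bounded_by_def)

lemma bit_length_le: "x < 2 ^ k \<Longrightarrow> 1 \<le> k \<Longrightarrow> bit_length x \<le> k"
  by (simp add: bit_length_def floorlog_le_iff)

lemma less_two_power_bit_length: "x < 2 ^ bit_length x"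
proof -
  have "x < 2 ^ floorlog 2 x"
    using floorlog_bounds[of x 2] by (cases "x = 0") auto
  also have "\<dots> \<le> 2 ^ bit_length x"
    by (rule power_increasing) (auto simp: bit_length_def)
  finally show ?thesis .
qed

lemma bit_length_ge_1: "1 \<le> bit_length x"
  by (simp add: bit_length_def)

section \<open>Values and costs of expressions\<close>

primrec asize :: "aexp \<Rightarrow> nat" where
  "asize (Lit c) = bit_length c"
| "asize (Arr x e) = 1 + asize e"
| "asize (Add a b) = asize a + asize b"
| "asize (Sub a b) = asize a + asize b"
| "asize (Mul a b) = asize a + asize b"
| "asize (Div a b) = asize a + asize b"

lemma asize_ge_1: "1 \<le> asize a"
  using bit_length_ge_1 by (induction a) auto

lemma add_less_two_power:
  fixes a b :: nat
  assumes "a < 2 ^ i" "b < 2 ^ j" "1 \<le> i" "1 \<le> j"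
  shows "a + b < 2 ^ (i + j)"
proof -
  have *: "(2::nat) ^ 1 \<le> 2 ^ i" "(2::nat) ^ 1 \<le> 2 ^ j"
    using assms by (intro power_increasing; simp)+
  then obtain x y :: nat where xy: "2 ^ i = 2 + x" "2 ^ j = 2 + y"
    by (metis le_Suc_ex power_one_right)
  have "a + b < (2 + x) + (2 + y)" using assms xy by simp
  also have "\<dots> \<le> (2 + x) * (2 + y)" by (simp add: algebra_simps)
  finally show ?thesis using xy by (simp add: power_add)
qed

lemma mult_less_two_power:
  fixes a b :: nat
  assumes "a < 2 ^ i" "b < 2 ^ j"
  shows "a * b < 2 ^ (i + j)"
  using assms by (simp add: power_add mult_strict_mono)

lemma aval_less:
  assumes "bounded_by M s" "1 \<le> M"
  shows "aval a s < 2 ^ (asize a * M)"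
proof (induction a)
  case (Lit c)
  have "(2::nat) ^ bit_length c \<le> 2 ^ (bit_length c * M)"
    using assms by (intro power_increasing) auto
  then show ?case using less_two_power_bit_length[of c] by (simp del: power_increasing_iff)
next
  case (Arr x e)
  have "aval (Arr x e) s < 2 ^ M" using assms by (simp add: bounded_by_def)
  also have "\<dots> \<le> 2 ^ (asize (Arr x e) * M)" by (intro power_increasing) auto
  finally show ?case .
next
  case (Add a b)
  have "1 \<le> asize a * M" "1 \<le> asize b * M" using assms asize_ge_1[of a] asize_ge_1[of b]
    by (simp_all add: Suc_le_eq)
  with add_less_two_power[OF Add] show ?case by (simp add: add_mult_distrib)
next
  case (Sub a b)
  have "aval (Sub a b) s < 2 ^ (asize a * M)" using Sub(1) by simp
  also have "\<dots> \<le> 2 ^ (asize (Sub a b) * M)" by (intro power_increasing) auto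
  finally show ?case .
next
  case (Mul a b)
  with mult_less_two_power[OF Mul] show ?case by (simp add: add_mult_distrib)
next
  case (Div a b)
  have "aval (Div a b) s < 2 ^ (asize a * M)"
    using Div(1) by (simp add: le_less_trans[OF div_le_dividend])
  also have "\<dots> \<le> 2 ^ (asize (Div a b) * M)" by (intro power_increasing) auto
  finally show ?case .
qed

lemma bit_length_aval_le:
  assumes "bounded_by M s" "1 \<le> M"
  shows "bit_length (aval a s) \<le> asize a * M"
proof (rule bit_length_le[OF aval_less[OF assms]])
  show "1 \<le> asize a * M" using assms asize_ge_1[of a] by (simp add: Suc_le_eq)
qed

lemma binary_cost_bound:
  assumes "\<exists>K. \<forall>s M. bounded_by M s \<and> 1 \<le> M \<longrightarrow> acost a s \<le> K * M"
    and "\<exists>K. \<forall>s M. bounded_by M s \<and> 1 \<le> M \<longrightarrow> acost b s \<le> K * M"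
  shows "\<exists>K. \<forall>s M. bounded_by M s \<and> 1 \<le> M \<longrightarrow>
    acost a s + acost b s + bit_length (aval a s) + bit_length (aval b s) \<le> K * M"
proof -
  from assms obtain K L where K: "\<And>s M. bounded_by M s \<and> 1 \<le> M \<Longrightarrow> acost a s \<le> K * M"
    "\<And>s M. bounded_by M s \<and> 1 \<le> M \<Longrightarrow> acost b s \<le> L * M" by blast
  have "acost a s + acost b s + bit_length (aval a s) + bit_length (aval b s)
      \<le> (K + L + asize a + asize b) * M" if "bounded_by M s \<and> 1 \<le> M" for s M
    using K(1,2)[OF that] bit_length_aval_le[of M s a] bit_length_aval_le[of M s b] that
    by (simp add: add_mult_distrib)
  then show ?thesis by blast
qed

lemma acost_bound: "\<exists>K. \<forall>s M. bounded_by M s \<and> 1 \<le> M \<longrightarrow> acost a s \<le> K * M"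
proof (induction a)
  case (Lit c)
  have "bit_length c \<le> bit_length c * M" if "1 \<le> M" for M using that by simp
  then show ?case by (intro exI[of _ "bit_length c"]) simp
next
  case (Arr x e)
  then obtain K where K: "\<And>s M. bounded_by M s \<and> 1 \<le> M \<Longrightarrow> acost e s \<le> K * M" by blast
  have "acost (Arr x e) s \<le> (K + asize e + 1) * M" if "bounded_by M s \<and> 1 \<le> M" for s M
    using K[OF that] bit_length_aval_le[of M s e] that bit_length_le[of "s x (aval e s)" M]
    by (simp add: add_mult_distrib bounded_by_def)
  then show ?case by blast
qed (use binary_cost_bound in simp_all)

lemma bcost_bound: "\<exists>K. \<forall>s M. bounded_by M s \<and> 1 \<le> M \<longrightarrow> bcost b s \<le> K * M"
proof (induction b)
  case (BConst v)
  show ?case by (intro exI[of _ 1]) simp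
next
  case (BNot b)
  then obtain K where K: "\<And>s M. bounded_by M s \<and> 1 \<le> M \<Longrightarrow> bcost b s \<le> K * M" by blast
  have "bcost (BNot b) s \<le> (K + 1) * M" if "bounded_by M s \<and> 1 \<le> M" for s M
    using K[OF that] that by (simp add: add_mult_distrib)
  then show ?case by blast
next
  case (BAnd a b)
  then obtain K L where K: "\<And>s M. bounded_by M s \<and> 1 \<le> M \<Longrightarrow> bcost a s \<le> K * M"
    "\<And>s M. bounded_by M s \<and> 1 \<le> M \<Longrightarrow> bcost b s \<le> L * M" by blast
  have "bcost (BAnd a b) s \<le> (K + L + 1) * M" if "bounded_by M s \<and> 1 \<le> M" for s M
    using K(1,2)[OF that] that by (simp add: add_mult_distrib)
  then show ?case by blast
next
  case (BLess a b)
  show ?case using binary_cost_bound[OF acost_bound acost_bound] by simp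
qed

lemma assign_bound:
  obtains K where "\<And>s M. bounded_by M s \<Longrightarrow> 1 \<le> M \<Longrightarrow>
    \<exists>\<tau>\<le>K * M. exec (Assign x e a) s \<tau> (upd x (aval e s) (aval a s) s)"
proof -
  obtain K L where K: "\<And>s M. bounded_by M s \<and> 1 \<le> M \<Longrightarrow> acost e s \<le> K * M"
    "\<And>s M. bounded_by M s \<and> 1 \<le> M \<Longrightarrow> acost a s \<le> L * M" using acost_bound by metis
  have "\<exists>\<tau>\<le>(K + L + asize e + asize a) * M. exec (Assign x e a) s \<tau> (upd x (aval e s) (aval a s) s)"
    if "bounded_by M s" "1 \<le> M" for s M
    using K(1,2)[of M s] bit_length_aval_le[of M s e] bit_length_aval_le[of M s a] that
      exec.Assign[of x e a s] unfolding upd_def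
    by (intro exI conjI) (auto simp: add_mult_distrib)
  with that show ?thesis by blast
qed

text \<open>The factor \<open>asize a\<close> in \<open>aval_less\<close> is good enough for the
  cost of one step, but iterating it would make lengths exponential. For stored values the bound is
  additive instead: an addition costs one more bit, a product with an input entry at most
  \<open>L\<close> more.\<close>

primrec agrow :: "aexp \<Rightarrow> nat" where
  "agrow (Lit c) = bit_length c"
| "agrow (Arr x e) = 0"
| "agrow (Add a b) = agrow a + agrow b + 1"
| "agrow (Sub a b) = agrow a"
| "agrow (Mul a b) = agrow a + 1"
| "agrow (Div a b) = agrow a"

lemma slow_aval_less:
  assumes "bounded_by M s" "inputs_bounded_by L s" "1 \<le> L"
  shows "slow a \<Longrightarrow> aval a s < 2 ^ (M + agrow a * L)"
proof (induction a)
  case (Lit c)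
  have "(2::nat) ^ bit_length c \<le> 2 ^ (M + bit_length c * L)"
    using assms by (intro power_increasing) (auto simp: trans_le_add2)
  then show ?case using less_two_power_bit_length[of c] by (simp del: power_increasing_iff)
next
  case (Arr x e)
  then show ?case using assms by (simp add: bounded_by_def)
next
  case (Add a b)
  let ?k = "M + (agrow a + agrow b) * L"
  have "(2::nat) ^ (M + agrow a * L) \<le> 2 ^ ?k" "(2::nat) ^ (M + agrow b * L) \<le> 2 ^ ?k"
    by (intro power_increasing; simp)+
  then have "aval a s < 2 ^ ?k" "aval b s < 2 ^ ?k" using Add by (auto elim!: less_le_trans)
  then have "aval (Add a b) s < 2 ^ (?k + 1)" by simp
  also have "\<dots> \<le> 2 ^ (M + agrow (Add a b) * L)"
    using assms by (intro power_increasing) (auto simp: add_mult_distrib)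
  finally show ?case .
next
  case (Mul a b)
  then obtain x e where b: "b = Arr x e" "x \<in> inputs" by (cases b) auto
  have "aval b s < 2 ^ L" using b assms by (simp add: inputs_bounded_by_def)
  with Mul mult_less_two_power[of "aval a s" "M + agrow a * L" "aval b s" L] show ?case
    by (simp add: algebra_simps)
next
  case (Div a b)
  then show ?case by (simp add: le_less_trans[OF div_le_dividend])
qed (auto intro: le_less_trans)

text \<open>The polynomial \<open>q\<close> bounds the growth of lengths independently of the
  current length \<open>M\<close>, and the time is linear in \<open>M\<close>. This form is stable
  under composition: running further programs, or up to \<open>L\<close> rounds of a loop, only adds
  up the increments.\<close>

definition poly_time :: "lcom \<Rightarrow> bool" where
  "poly_time c \<longleftrightarrow> (\<exists>p q :: nat poly. \<forall>s M L.
     bounded_by M s \<longrightarrow> inputs_bounded_by L s \<longrightarrow> 1 \<le> L \<longrightarrow> L \<le> M \<longrightarrow> s ''n'' 0 \<le> L \<longrightarrow>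
     (\<exists>\<tau>\<le>poly p L * (M + poly q L). exec (compile c) s \<tau> (den c s)) \<and>
     bounded_by (M + poly q L) (den c s))"

lemma poly_timeI:
  assumes "\<And>s M L. bounded_by M s \<Longrightarrow> inputs_bounded_by L s \<Longrightarrow> 1 \<le> L \<Longrightarrow> L \<le> M \<Longrightarrow> s ''n'' 0 \<le> L \<Longrightarrow>
     (\<exists>\<tau>\<le>poly p L * (M + poly q L). exec (compile c) s \<tau> (den c s)) \<and>
     bounded_by (M + poly q L) (den c s)"
  shows "poly_time c"
  unfolding poly_time_def using assms by blast

lemma poly_timeE:
  assumes "poly_time c"
  obtains p q :: "nat poly" where "\<And>s M L. bounded_by M s \<Longrightarrow> inputs_bounded_by L s \<Longrightarrow> 1 \<le> L \<Longrightarrow>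
     L \<le> M \<Longrightarrow> s ''n'' 0 \<le> L \<Longrightarrow>
     (\<exists>\<tau>\<le>poly p L * (M + poly q L). exec (compile c) s \<tau> (den c s)) \<and>
     bounded_by (M + poly q L) (den c s)"
  using assms unfolding poly_time_def by blast

lemma poly_time_For:
  assumes wf: "wf_prog (LFor v c)" and c: "poly_time c"
  shows "poly_time (LFor v c)"
proof -
  let ?b = "BLess (scalar v) (Add (scalar ''n'') (Lit 1))"
  let ?inc = "Assign v (Lit 0) (Add (scalar v) (Lit 1))"
  let ?W = "While ?b (Seq (compile c) ?inc)"
  let ?f = "\<lambda>i u. den c (upd v 0 i u)"
  have v: "v \<noteq> ''n''" "v \<notin> inputs" "v \<notin> assigned c" and wfc: "wf_prog c"
    using wf by (auto simp: inputs_def)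
  from c obtain p q where pq: "\<And>s M L. bounded_by M s \<Longrightarrow> inputs_bounded_by L s \<Longrightarrow> 1 \<le> L \<Longrightarrow>
     L \<le> M \<Longrightarrow> s ''n'' 0 \<le> L \<Longrightarrow>
     (\<exists>\<tau>\<le>poly p L * (M + poly q L). exec (compile c) s \<tau> (den c s)) \<and>
     bounded_by (M + poly q L) (den c s)" by (rule poly_timeE) blast
  obtain K1 where K1: "\<And>s M. bounded_by M s \<Longrightarrow> 1 \<le> M \<Longrightarrow> bcost ?b s \<le> K1 * M"
    using bcost_bound by metis
  obtain K2 where K2: "\<And>s M. bounded_by M s \<Longrightarrow> 1 \<le> M \<Longrightarrow>
    \<exists>\<tau>\<le>K2 * M. exec ?inc s \<tau> (upd v (aval (Lit 0) s) (aval (Add (scalar v) (Lit 1)) s) s)"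
    by (rule assign_bound[of v "Lit 0" "Add (scalar v) (Lit 1)"]) blast
  obtain K3 where K3: "\<And>s M. bounded_by M s \<Longrightarrow> 1 \<le> M \<Longrightarrow>
    \<exists>\<tau>\<le>K3 * M. exec (Assign v (Lit 0) (Lit 1)) s \<tau> (upd v (aval (Lit 0) s) (aval (Lit 1) s) s)"
    by (rule assign_bound[of v "Lit 0" "Lit 1"]) blast
  \<comment> \<open>Induction on the number \<open>d\<close> of remaining rounds. The extra
    \<open>+ 1\<close> makes room for the exit value \<open>Suc N\<close> of the counter, which is
    only known to be at most \<open>2 ^ M\<close>.\<close>
  have loop: "(\<exists>\<tau>\<le>(d * (poly p L + K1 + K2) + K1) * (M + d * poly q L + 1).
        exec ?W (upd v 0 i u) \<tau> (upd v 0 (Suc N) (fold ?f [i..<Suc N] u))) \<and>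
      bounded_by (M + d * poly q L) (fold ?f [i..<Suc N] u)"
    if "bounded_by M u" "inputs_bounded_by L u" "1 \<le> L" "L \<le> M" "u ''n'' 0 = N" "N \<le> L"
      "i + d = Suc N" for d i u M L N
    using that
  proof (induction d arbitrary: i u M)
    case 0
    then have i: "i = Suc N" by simp
    have "Suc N \<le> 2 ^ M" using 0 less_exp[of N]
      by (meson Suc_leI le_trans one_le_numeral order_refl power_increasing)
    then have "bounded_by (M + 1) (upd v 0 (Suc N) u)"
      using 0 bounded_by_mono[of M u "M + 1"] by (intro bounded_by_upd) (auto intro: le_less_trans)
    then have "bcost ?b (upd v 0 (Suc N) u) \<le> K1 * (M + 1)"
      by (rule K1) simp
    moreover have "exec ?W (upd v 0 (Suc N) u) (bcost ?b (upd v 0 (Suc N) u)) (upd v 0 (Suc N) u)"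
      using 0 v by (intro exec.WhileFalse) simp
    moreover have "fold ?f [i..<Suc N] u = u" using i by simp
    ultimately show ?case using 0(1) i by (metis add.right_neutral mult_0 add_0)
  next
    case (Suc d)
    let ?u = "upd v 0 i u" and ?q = "poly q L"
    have i: "i \<le> N" using Suc by simp
    have "i < 2 ^ M" using i Suc.prems less_exp[of M] by linarith
    then have bu: "bounded_by M ?u" using Suc.prems by (intro bounded_by_upd)
    have iu: "inputs_bounded_by L ?u"
      using Suc.prems(2) v by (auto simp: inputs_bounded_by_def upd_def)
    have nu: "?u ''n'' 0 = N" using Suc.prems v by simp
    from pq[OF bu iu] Suc.prems nu obtain t1 where
      t1: "t1 \<le> poly p L * (M + ?q)" "exec (compile c) ?u t1 (den c ?u)"
      and b1: "bounded_by (M + ?q) (den c ?u)" by auto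
    have fr: "den c ?u v 0 = i" "den c ?u ''n'' 0 = N"
      using den_frame[OF v(3), of ?u] den_frame[of "''n''" c ?u] assigned_inputs[OF wfc, of "''n''"] nu
      by (auto simp: inputs_def)
    have i1: "inputs_bounded_by L (den c ?u)"
      using iu den_frame assigned_inputs[OF wfc] inputs_bounded_by_cong by metis
    from K2[OF b1] Suc.prems obtain t2 where
      t2: "t2 \<le> K2 * (M + ?q)" "exec ?inc (den c ?u) t2 (upd v 0 (Suc i) (den c ?u))"
      using fr by auto
    have "L \<le> M + ?q" "Suc i + d = Suc N" using Suc.prems by auto
    from Suc.IH[of "M + ?q" "den c ?u" "Suc i", OF b1 i1 Suc.prems(3) this(1) fr(2) Suc.prems(6) this(2)]
    obtain t3 where
      t3: "t3 \<le> (d * (poly p L + K1 + K2) + K1) * (M + ?q + d * ?q + 1)"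
        "exec ?W (upd v 0 (Suc i) (den c ?u)) t3
          (upd v 0 (Suc N) (fold ?f [Suc i..<Suc N] (den c ?u)))"
      and b3: "bounded_by (M + ?q + d * ?q) (fold ?f [Suc i..<Suc N] (den c ?u))"
      by blast
    have fold: "fold ?f [i..<Suc N] u = fold ?f [Suc i..<Suc N] (den c ?u)"
      using i by (subst upt_conv_Cons) auto
    have bt: "bcost ?b ?u \<le> K1 * M" using K1[OF bu] Suc.prems by simp
    have "exec ?W ?u (bcost ?b ?u + (t1 + t2) + t3)
        (upd v 0 (Suc N) (fold ?f [Suc i..<Suc N] (den c ?u)))"
      using i nu v by (intro exec.WhileTrue[OF _ exec.Seq[OF t1(2) t2(2)] t3(2)]) simp
    moreover have "bcost ?b ?u + (t1 + t2) + t3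
        \<le> (Suc d * (poly p L + K1 + K2) + K1) * (M + Suc d * ?q + 1)"
    proof -
      let ?B = "M + Suc d * ?q + 1"
      have "bcost ?b ?u \<le> K1 * ?B" using bt by (rule le_trans) (intro mult_le_mono2, simp)
      moreover have "t1 \<le> poly p L * ?B" using t1(1) by (rule le_trans) (intro mult_le_mono2, simp)
      moreover have "t2 \<le> K2 * ?B" using t2(1) by (rule le_trans) (intro mult_le_mono2, simp)
      moreover have "t3 \<le> (d * (poly p L + K1 + K2) + K1) * ?B" using t3(1) by (simp add: add_ac)
      ultimately have "bcost ?b ?u + (t1 + t2) + t3
          \<le> K1 * ?B + (poly p L * ?B + K2 * ?B) + (d * (poly p L + K1 + K2) + K1) * ?B"
        by (intro add_mono)
      also have "\<dots> = (Suc d * (poly p L + K1 + K2) + K1) * ?B"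
        by (simp only: add_mult_distrib mult_Suc add_ac)
      finally show ?thesis .
    qed
    ultimately show ?case using b3 fold by (auto simp: add_ac intro!: exI)
  qed
  \<comment> \<open>The factor \<open>[:0, 1:]\<close> evaluates to \<open>L\<close>, which bounds
    the number of rounds; the constant 1 in \<open>q'\<close> is the extra bit for the exit value of
    the counter.\<close>
  define p' where "p' = [:0, 1:] * (p + [:K1 + K2:]) + [:K1 + K3:]"
  define q' where "q' = [:0, 1:] * q + [:1:]"
  show ?thesis
  proof (rule poly_timeI[of p' q'])
    fix s :: state and M L
    assume s: "bounded_by M s" "inputs_bounded_by L s" "1 \<le> L" "L \<le> M" "s ''n'' 0 \<le> L"
    let ?N = "s ''n'' 0" and ?q = "poly q L" and ?B = "M + poly q' L"
    have B: "M + ?N * ?q + 1 \<le> ?B" using s by (simp add: q'_def)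
    from K3[OF s(1)] s obtain t1 where
      t1: "t1 \<le> K3 * M" "exec (Assign v (Lit 0) (Lit 1)) s t1 (upd v 0 1 s)" by auto
    from loop[of M s L ?N 1 ?N] s obtain t2 where
      t2: "t2 \<le> (?N * (poly p L + K1 + K2) + K1) * (M + ?N * ?q + 1)"
        "exec ?W (upd v 0 1 s) t2 (upd v 0 (Suc ?N) (fold ?f [1..<Suc ?N] s))"
      and b: "bounded_by (M + ?N * ?q) (fold ?f [1..<Suc ?N] s)" by auto
    have "t1 \<le> K3 * ?B" using t1(1) by (rule le_trans) (intro mult_le_mono2, simp)
    moreover have "t2 \<le> (L * (poly p L + K1 + K2) + K1) * ?B"
      using t2(1) by (rule le_trans) (intro mult_le_mono add_mono order_refl s B)
    ultimately have "t1 + t2 \<le> poly p' L * ?B" by (simp add: p'_def algebra_simps)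
    moreover have "exec (compile (LFor v c)) s (t1 + t2) (den (LFor v c) s)"
      using exec.Seq[OF t1(2) t2(2)] by simp
    moreover have "bounded_by ?B (den (LFor v c) s)"
    proof -
      have "Suc ?N \<le> 2 ^ M" using s less_exp[of ?N]
        by (meson Suc_leI le_trans one_le_numeral order_refl power_increasing)
      also have "(2::nat) ^ M < 2 ^ ?B" using B by (intro power_strict_increasing) auto
      finally have "bounded_by ?B (upd v 0 (Suc ?N) (fold ?f [1..<Suc ?N] s))"
        using B by (intro bounded_by_upd bounded_by_mono[OF b]) auto
      then show ?thesis by simp
    qed
    ultimately show "(\<exists>\<tau>\<le>poly p' L * ?B. exec (compile (LFor v c)) s \<tau> (den (LFor v c) s)) \<and>
        bounded_by ?B (den (LFor v c) s)" by blast
  qed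
qed

theorem wf_prog_poly_time: "wf_prog c \<Longrightarrow> poly_time c"
proof (induction c)
  case LSkip
  show ?case
    by (rule poly_timeI[of 1 0]) (auto intro!: exI[of _ 1] exec.Skip)
next
  case (LAssign x e a)
  obtain K where K: "\<And>s M. bounded_by M s \<Longrightarrow> 1 \<le> M \<Longrightarrow>
    \<exists>\<tau>\<le>K * M. exec (Assign x e a) s \<tau> (upd x (aval e s) (aval a s) s)"
    by (rule assign_bound[of x e a]) blast
  show ?case
  proof (rule poly_timeI[of "[:K:]" "[:0, agrow a:]"])
    fix s :: state and M L
    assume s: "bounded_by M s" "inputs_bounded_by L s" "1 \<le> L" "L \<le> M"
    from K[OF s(1)] s obtain t where
      t: "t \<le> K * M" "exec (Assign x e a) s t (upd x (aval e s) (aval a s) s)" by auto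
    have "t \<le> K * (M + agrow a * L)" using t(1) by (rule le_trans) simp
    moreover have "bounded_by (M + agrow a * L) (upd x (aval e s) (aval a s) s)"
      using LAssign s by (intro bounded_by_upd bounded_by_mono[OF s(1)] slow_aval_less) auto
    ultimately show "(\<exists>\<tau>\<le>poly [:K:] L * (M + poly [:0, agrow a:] L).
        exec (compile (LAssign x e a)) s \<tau> (den (LAssign x e a) s)) \<and>
        bounded_by (M + poly [:0, agrow a:] L) (den (LAssign x e a) s)"
      using t(2) by (auto simp: mult.commute)
  qed
next
  case (LSeq c d)
  then have "poly_time c" "poly_time d" by auto
  from this(1) obtain p q where pq: "\<And>s M L. bounded_by M s \<Longrightarrow> inputs_bounded_by L s \<Longrightarrow> 1 \<le> L \<Longrightarrow>
     L \<le> M \<Longrightarrow> s ''n'' 0 \<le> L \<Longrightarrow>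
     (\<exists>\<tau>\<le>poly p L * (M + poly q L). exec (compile c) s \<tau> (den c s)) \<and>
     bounded_by (M + poly q L) (den c s)" by (rule poly_timeE) blast
  from \<open>poly_time d\<close> obtain p' q' where pq': "\<And>s M L. bounded_by M s \<Longrightarrow> inputs_bounded_by L s \<Longrightarrow>
     1 \<le> L \<Longrightarrow> L \<le> M \<Longrightarrow> s ''n'' 0 \<le> L \<Longrightarrow>
     (\<exists>\<tau>\<le>poly p' L * (M + poly q' L). exec (compile d) s \<tau> (den d s)) \<and>
     bounded_by (M + poly q' L) (den d s)" by (rule poly_timeE) blast
  show ?case
  proof (rule poly_timeI[of "p + p'" "q + q'"])
    fix s :: state and M L
    assume s: "bounded_by M s" "inputs_bounded_by L s" "1 \<le> L" "L \<le> M" "s ''n'' 0 \<le> L"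
    let ?B = "M + poly (q + q') L"
    have fr: "x \<in> inputs \<Longrightarrow> den c s x = s x" for x
      using den_frame assigned_inputs LSeq.prems by simp
    from pq[OF s] obtain t1 where t1: "t1 \<le> poly p L * (M + poly q L)"
      "exec (compile c) s t1 (den c s)" and b: "bounded_by (M + poly q L) (den c s)" by auto
    have "inputs_bounded_by L (den c s)" using s(2) fr by (rule inputs_bounded_by_cong)
    moreover have "den c s ''n'' 0 = s ''n'' 0" using fr by (simp add: inputs_def)
    ultimately obtain t2 where t2: "t2 \<le> poly p' L * (M + poly q L + poly q' L)"
      "exec (compile d) (den c s) t2 (den d (den c s))"
      and b2: "bounded_by (M + poly q L + poly q' L) (den d (den c s))"
      using pq'[OF b, of L] s by auto
    have "t1 \<le> poly p L * ?B" using t1(1) by (rule le_trans) simp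
    then have "t1 + t2 \<le> poly (p + p') L * ?B" using t2(1) by (simp add: algebra_simps)
    moreover have "exec (compile (LSeq c d)) s (t1 + t2) (den (LSeq c d) s)"
      using exec.Seq[OF t1(2) t2(2)] by simp
    ultimately show "(\<exists>\<tau>\<le>poly (p + p') L * ?B. exec (compile (LSeq c d)) s \<tau> (den (LSeq c d) s)) \<and>
        bounded_by ?B (den (LSeq c d) s)" using b2 by (auto simp: add_ac)
  qed
next
  case (LIf b c d)
  then have "poly_time c" "poly_time d" by auto
  from this(1) obtain p q where pq: "\<And>s M L. bounded_by M s \<Longrightarrow> inputs_bounded_by L s \<Longrightarrow> 1 \<le> L \<Longrightarrow>
     L \<le> M \<Longrightarrow> s ''n'' 0 \<le> L \<Longrightarrow>
     (\<exists>\<tau>\<le>poly p L * (M + poly q L). exec (compile c) s \<tau> (den c s)) \<and>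
     bounded_by (M + poly q L) (den c s)" by (rule poly_timeE) blast
  from \<open>poly_time d\<close> obtain p' q' where pq': "\<And>s M L. bounded_by M s \<Longrightarrow> inputs_bounded_by L s \<Longrightarrow>
     1 \<le> L \<Longrightarrow> L \<le> M \<Longrightarrow> s ''n'' 0 \<le> L \<Longrightarrow>
     (\<exists>\<tau>\<le>poly p' L * (M + poly q' L). exec (compile d) s \<tau> (den d s)) \<and>
     bounded_by (M + poly q' L) (den d s)" by (rule poly_timeE) blast
  obtain K where K: "\<And>s M. bounded_by M s \<Longrightarrow> 1 \<le> M \<Longrightarrow> bcost b s \<le> K * M"
    using bcost_bound by metis
  show ?case
  \<comment> \<open>Over the naturals a sum of polynomials dominates each summand, so it covers
    whichever branch is taken.\<close>
  proof (rule poly_timeI[of "p + p' + [:K:]" "q + q'"])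
    fix s :: state and M L
    assume s: "bounded_by M s" "inputs_bounded_by L s" "1 \<le> L" "L \<le> M" "s ''n'' 0 \<le> L"
    let ?B = "M + poly (q + q') L"
    let ?e = "if bval b s then c else d"
    obtain t where t: "t \<le> (poly p L + poly p' L) * ?B" "exec (compile ?e) s t (den ?e s)"
      "bounded_by ?B (den ?e s)"
    proof (cases "bval b s")
      case True
      from pq[OF s] obtain t1 where t1: "t1 \<le> poly p L * (M + poly q L)"
        "exec (compile c) s t1 (den c s)" and b: "bounded_by (M + poly q L) (den c s)" by auto
      have "poly p L * (M + poly q L) \<le> (poly p L + poly p' L) * ?B" by (intro mult_le_mono) auto
      then have "t1 \<le> (poly p L + poly p' L) * ?B" using t1(1) by (rule le_trans[rotated])
      moreover have "bounded_by ?B (den c s)" by (rule bounded_by_mono[OF b]) simp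
      ultimately show ?thesis using t1(2) True that[of t1] by simp
    next
      case False
      from pq'[OF s] obtain t1 where t1: "t1 \<le> poly p' L * (M + poly q' L)"
        "exec (compile d) s t1 (den d s)" and b: "bounded_by (M + poly q' L) (den d s)" by auto
      have "poly p' L * (M + poly q' L) \<le> (poly p L + poly p' L) * ?B" by (intro mult_le_mono) auto
      then have "t1 \<le> (poly p L + poly p' L) * ?B" using t1(1) by (rule le_trans[rotated])
      moreover have "bounded_by ?B (den d s)" by (rule bounded_by_mono[OF b]) simp
      ultimately show ?thesis using t1(2) False that[of t1] by simp
    qed
    have "bcost b s \<le> K * ?B" using K[OF s(1)] s by (meson le_add1 le_trans mult_le_mono2)
    then have "bcost b s + t \<le> poly (p + p' + [:K:]) L * ?B"
      using t(1) by (simp add: algebra_simps)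
    moreover have "exec (compile (LIf b c d)) s (bcost b s + t) (den (LIf b c d) s)"
      using t(2) exec.CondTrue exec.CondFalse by (auto split: if_splits)
    ultimately show "(\<exists>\<tau>\<le>poly (p + p' + [:K:]) L * ?B.
        exec (compile (LIf b c d)) s \<tau> (den (LIf b c d) s)) \<and> bounded_by ?B (den (LIf b c d) s)"
      using t(3) by (auto split: if_splits)
  qed
next
  case (LFor v c)
  then show ?case using poly_time_For by simp
qed

section \<open>Packings with one large bin\<close>

context
  fixes W :: "nat \<Rightarrow> nat" and D :: nat
begin

text \<open>Removes \<open>p\<close> singles and \<open>m\<close> pairs from a set and leaves the
  rest \<open>R\<close>; which items form which bin is forgotten. Singles carry no size condition
  because every item of an instance fits alone.\<close>

inductive peel :: "nat set \<Rightarrow> nat \<Rightarrow> nat \<Rightarrow> nat set \<Rightarrow> bool" where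
  rest: "peel R 0 0 R"
| single: "peel U p m R \<Longrightarrow> x \<notin> U \<Longrightarrow> peel (insert x U) (Suc p) m R"
| pair: "peel U p m R \<Longrightarrow> x \<notin> U \<Longrightarrow> y \<notin> U \<Longrightarrow> x \<noteq> y \<Longrightarrow> W x + W y \<le> D \<Longrightarrow>
    peel (insert x (insert y U)) p (Suc m) R"

lemma peel_subset: "peel U p m R \<Longrightarrow> R \<subseteq> U"
  by (induction rule: peel.induct) auto

lemma peel_card: "peel U p m R \<Longrightarrow> finite U \<Longrightarrow> card U = p + 2 * m + card R"
  by (induction rule: peel.induct) auto

lemma peel_weaken: "peel U p m R \<Longrightarrow> A \<inter> U = {} \<Longrightarrow> peel (U \<union> A) p m (R \<union> A)"
  by (induction rule: peel.induct) (simp_all add: peel.intros)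

lemma peel_trans: "peel U p m R \<Longrightarrow> peel R p' m' R' \<Longrightarrow> peel U (p + p') (m + m') R'"
  by (induction rule: peel.induct) (simp_all add: peel.intros)

lemma peel_union:
  assumes "peel U p m R" "peel A p' m' {}" "A \<inter> U = {}"
  shows "peel (U \<union> A) (p + p') (m + m') R"
proof -
  have "peel (A \<union> R) p' m' ({} \<union> R)"
    using assms peel_subset[OF assms(1)] by (intro peel_weaken) auto
  then show ?thesis using peel_trans[OF peel_weaken[OF assms(1,3)]] by (simp add: Un_commute)
qed

lemma peel_remove_rest: "peel U p m R \<Longrightarrow> e \<in> R \<Longrightarrow> peel (U - {e}) p m (R - {e})"
proof (induction rule: peel.induct)
  case (single U p m R x)
  then have "e \<in> U" using peel_subset by blast
  then have "insert x U - {e} = insert x (U - {e})" using single by auto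
  then show ?case using single by (auto intro: peel.intros)
next
  case (pair U p m R x y)
  then have "e \<in> U" using peel_subset by blast
  then have "insert x (insert y U) - {e} = insert x (insert y (U - {e}))" using pair by auto
  then show ?case using pair by (auto intro: peel.intros)
qed (rule peel.intros)

text \<open>Removals of disjoint bins commute, so some single can be taken out first even if the
  derivation ends with a pair.\<close>

lemma peel_singleE: "peel U p m R \<Longrightarrow> p = Suc p' \<Longrightarrow> \<exists>x\<in>U. peel (U - {x}) p' m R \<and> x \<notin> R"
proof (induction arbitrary: p' rule: peel.induct)
  case (single U p m R x)
  then show ?case using peel_subset[of U p m R] by (intro bexI[of _ x]) auto
next
  case (pair U p m R x y)
  then obtain z where z: "z \<in> U" "peel (U - {z}) p' m R" "z \<notin> R" by blast
  then have "insert x (insert y U) - {z} = insert x (insert y (U - {z}))" using pair by auto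
  moreover have "peel (insert x (insert y (U - {z}))) p' (Suc m) R"
    using z pair by (intro peel.pair) auto
  ultimately show ?case using z by (intro bexI[of _ z]) auto
qed simp

lemma peel_pairE:
  assumes "peel U 0 (Suc m) R"
  obtains x y where "x \<in> U" "y \<in> U" "x \<noteq> y" "W x + W y \<le> D" "peel (U - {x, y}) 0 m R"
    "x \<notin> R" "y \<notin> R"
  using assms
proof (cases rule: peel.cases)
  case (pair V x y)
  then have "U - {x, y} = V" by auto
  moreover have "R \<subseteq> V" using pair peel_subset by blast
  ultimately show ?thesis using pair by (intro that[of x y]) auto
qed

text \<open>Without singles, an item outside the rest must lie in a pair, and that pair can be moved
  to the front of the derivation.\<close>

lemma peel_pair_with:
  "peel U 0 m R \<Longrightarrow> t \<in> U \<Longrightarrow> t \<in> R \<or>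
    (\<exists>z m'. m = Suc m' \<and> z \<in> U \<and> z \<noteq> t \<and> W t + W z \<le> D \<and> peel (U - {t, z}) 0 m' R)"
proof (induction m arbitrary: U)
  case 0
  then show ?case by (auto elim: peel.cases)
next
  case (Suc m)
  from Suc.prems(1) obtain x y where xy: "x \<in> U" "y \<in> U" "x \<noteq> y" "W x + W y \<le> D"
    "peel (U - {x, y}) 0 m R" by (rule peel_pairE)
  consider "t = x" | "t = y" | "t \<in> U - {x, y}" using Suc.prems by blast
  then show ?case
  proof cases
    case 1
    then show ?thesis using xy by blast
  next
    case 2
    then show ?thesis using xy by (auto simp: insert_commute add.commute)
  next
    case 3
    from Suc.IH[OF xy(5) 3] show ?thesis
    proof
      assume "\<exists>z m'. m = Suc m' \<and> z \<in> U - {x, y} \<and> z \<noteq> t \<and> W t + W z \<le> D \<and>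
        peel (U - {x, y} - {t, z}) 0 m' R"
      then obtain z m' where z: "m = Suc m'" "z \<in> U - {x, y}" "z \<noteq> t" "W t + W z \<le> D"
        "peel (U - {x, y} - {t, z}) 0 m' R" by blast
      have "peel (insert x (insert y (U - {x, y} - {t, z}))) 0 (Suc m') R"
        using z xy by (intro peel.pair) auto
      also have "insert x (insert y (U - {x, y} - {t, z})) = U - {t, z}" using 3 z xy by auto
      finally show ?thesis using z by auto
    qed simp
  qed
qed

text \<open>The smaller item \<open>y\<close> takes over the role of \<open>x\<close>. A pair keeps
  fitting because its sum can only drop, and the rest changes only if \<open>x\<close> belonged to
  it. In the applications \<open>y\<close> has just been removed from the set, so that
  \<open>x\<close> and \<open>y\<close> swap places.\<close>

lemma peel_exchange:
  "peel U p m R \<Longrightarrow> x \<in> U \<Longrightarrow> y \<notin> U \<Longrightarrow> W y \<le> W x \<Longrightarrow>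
    \<exists>R'. peel (insert y (U - {x})) p m R' \<and> (R' = R \<or> x \<in> R \<and> R' = insert y (R - {x}))"
proof (induction rule: peel.induct)
  case (rest R)
  then show ?case by (auto intro: peel.rest)
next
  case (single U p m R a)
  show ?case
  proof (cases "x = a")
    case True
    then have "insert y (insert a U - {x}) = insert y U" using single by auto
    then show ?thesis using single by (auto intro: peel.single)
  next
    case False
    then obtain R' where R': "peel (insert y (U - {x})) p m R'"
      "R' = R \<or> x \<in> R \<and> R' = insert y (R - {x})" using single by auto
    have "insert y (insert a U - {x}) = insert a (insert y (U - {x}))" using False by auto
    then show ?thesis using R' single by (intro exI[of _ R']) (auto intro!: peel.single)
  qed
next
  case (pair U p m R a b)
  consider "x = a" | "x = b" | "x \<in> U" "x \<noteq> a" "x \<noteq> b" using pair by auto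
  then show ?case
  proof cases
    case 1
    then have "insert y (insert a (insert b U) - {x}) = insert y (insert b U)" using pair by auto
    then show ?thesis using pair 1 by (auto intro!: peel.pair)
  next
    case 2
    then have "insert y (insert a (insert b U) - {x}) = insert a (insert y U)" using pair by auto
    then show ?thesis using pair 2 by (auto intro!: peel.pair)
  next
    case 3
    then obtain R' where R': "peel (insert y (U - {x})) p m R'"
      "R' = R \<or> x \<in> R \<and> R' = insert y (R - {x})" using pair by auto
    have "insert y (insert a (insert b U) - {x}) = insert a (insert b (insert y (U - {x})))"
      using 3 by auto
    then show ?thesis using R' pair by (intro exI[of _ R']) (auto intro!: peel.pair)
  qed
qed

text \<open>The large bin is \<open>insert e R\<close>. Keeping \<open>e\<close> outside of
  \<open>U\<close> ensures that neither an exchange nor a greedy choice can touch it.\<close>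

definition completable :: "nat \<Rightarrow> nat set \<Rightarrow> nat \<Rightarrow> nat \<Rightarrow> bool" where
  "completable e U p m \<longleftrightarrow> finite U \<and> e \<notin> U \<and>
     (\<exists>R. peel U p m R \<and> W e + sum W R \<le> D \<and> (\<forall>i\<in>R. W i \<le> W e))"

section \<open>Exchange arguments behind the greedy choices\<close>

lemma completable_exchange:
  assumes "completable e U p m" "x \<in> U" "y \<notin> U" "y \<noteq> e" "W y \<le> W x"
  shows "completable e (insert y (U - {x})) p m"
proof -
  from assms obtain R where R: "peel U p m R" "W e + sum W R \<le> D" "\<forall>i\<in>R. W i \<le> W e"
    and U: "finite U" "e \<notin> U" by (auto simp: completable_def)
  from peel_exchange[OF R(1) assms(2,3,5)] obtain R' where
    R': "peel (insert y (U - {x})) p m R'" "R' = R \<or> x \<in> R \<and> R' = insert y (R - {x})" by blast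
  have fR: "finite R" and yR: "y \<notin> R" using U peel_subset[OF R(1)] finite_subset assms(3) by auto
  have "sum W R' \<le> sum W R \<and> (\<forall>i\<in>R'. W i \<le> W e)"
    using R'(2)
  proof
    assume "x \<in> R \<and> R' = insert y (R - {x})"
    then show ?thesis using R(3) fR yR assms(5) by (auto simp: sum.remove[of R x])
  qed (use R in simp)
  then show ?thesis using R R' U assms unfolding completable_def by (auto intro!: exI[of _ R'])
qed

text \<open>If a completion removes another single \<open>x\<close>, then \<open>x\<close> and
  \<open>t\<close> swap roles: \<open>t\<close> leaves alone, and \<open>x\<close>, being no larger,
  fits wherever \<open>t\<close> was.\<close>

lemma completable_single:
  assumes "completable e U (Suc p) m" "t \<in> U" "\<And>i. i \<in> U \<Longrightarrow> W i \<le> W t"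
  shows "completable e (U - {t}) p m"
proof -
  from assms obtain R where R: "peel U (Suc p) m R" "W e + sum W R \<le> D" "\<forall>i\<in>R. W i \<le> W e"
    and U: "finite U" "e \<notin> U" by (auto simp: completable_def)
  from peel_singleE[OF R(1) refl] obtain x where x: "x \<in> U" "peel (U - {x}) p m R" by blast
  have c: "completable e (U - {x}) p m" using R x U by (auto simp: completable_def)
  show ?thesis
  proof (cases "x = t")
    case False
    have "completable e (insert x (U - {x} - {t})) p m"
      using False x assms U by (intro completable_exchange[OF c]) auto
    also have "insert x (U - {x} - {t}) = U - {t}" using x False by auto
    finally show ?thesis .
  qed (use c in simp)
qed

text \<open>
  If the largest item \<open>t\<close> of \<open>U\<close> lies in the large bin, then \<open>W t \<le> W e\<close> forces \<open>2 * W t \<le> D\<close>,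
  so that any two items of \<open>U\<close> can be paired and \<open>t\<close> can be moved into a pair.
\<close>

lemma completable_pair_largest:
  assumes "completable e U 0 (Suc m)" "t \<in> U" "\<And>i. i \<in> U \<Longrightarrow> W i \<le> W t"
  shows "\<exists>z\<in>U - {t}. W t + W z \<le> D \<and> completable e (U - {t, z}) 0 m"
proof -
  from assms obtain R where R: "peel U 0 (Suc m) R" "W e + sum W R \<le> D" "\<forall>i\<in>R. W i \<le> W e"
    and U: "finite U" "e \<notin> U" by (auto simp: completable_def)
  from peel_pair_with[OF R(1) assms(2)] show ?thesis
  proof
    assume t: "t \<in> R"
    have "finite R" using U peel_subset[OF R(1)] finite_subset by auto
    then have "W t \<le> sum W R" using t by (simp add: member_le_sum)
    then have t2: "2 * W t \<le> D" using R t by fastforce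
    from R(1) obtain x y where xy: "x \<in> U" "y \<in> U" "x \<noteq> y" "W x + W y \<le> D"
      "peel (U - {x, y}) 0 m R" "x \<notin> R" "y \<notin> R" by (rule peel_pairE)
    then have txy: "t \<noteq> x" "t \<noteq> y" using t by auto
    have c: "completable e (U - {x, y}) 0 m" using R xy U by (auto simp: completable_def)
    have "completable e (insert x (U - {x, y} - {t})) 0 m"
      using xy txy assms U by (intro completable_exchange[OF c]) auto
    also have "insert x (U - {x, y} - {t}) = U - {t, y}" using xy txy by auto
    finally show ?thesis using xy txy t2 assms(3)[of y] by (intro bexI[of _ y]) auto
  next
    assume "\<exists>z m'. Suc m = Suc m' \<and> z \<in> U \<and> z \<noteq> t \<and> W t + W z \<le> D \<and> peel (U - {t, z}) 0 m' R"
    then show ?thesis using R U by (auto simp: completable_def)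
  qed
qed

text \<open>Whatever partner \<open>z\<close> a completion gives to \<open>t\<close>, it is at most
  as large as the best fit \<open>u\<close>, so \<open>z\<close> can move to the place of
  \<open>u\<close> in what remains.\<close>

lemma completable_pair:
  assumes "completable e U 0 (Suc m)" "t \<in> U" "\<And>i. i \<in> U \<Longrightarrow> W i \<le> W t"
    and u: "u \<in> U - {t}" "\<And>i. i \<in> U - {t} \<Longrightarrow> W t + W i \<le> D \<Longrightarrow> W i \<le> W u"
  shows "completable e (U - {t, u}) 0 m"
proof -
  from completable_pair_largest[OF assms(1-3)] obtain z where
    z: "z \<in> U - {t}" "W t + W z \<le> D" and c: "completable e (U - {t, z}) 0 m" by blast
  show ?thesis
  proof (cases "z = u")
    case False
    have "completable e (insert z (U - {t, z} - {u})) 0 m"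
      using False z u assms(1) by (intro completable_exchange[OF c]) (auto simp: completable_def)
    also have "insert z (U - {t, z} - {u}) = U - {t, u}" using z u False by auto
    finally show ?thesis .
  qed (use c in simp)
qed

section \<open>Splitting even bins and pooling odd bins\<close>

lemma peel_even:
  "finite A \<Longrightarrow> even (card A) \<Longrightarrow> (\<And>x y. x \<in> A \<Longrightarrow> y \<in> A \<Longrightarrow> x \<noteq> y \<Longrightarrow> W x + W y \<le> D) \<Longrightarrow>
    peel A 0 (card A div 2) {}"
proof (induction "card A" arbitrary: A rule: less_induct)
  case less
  show ?case
  proof (cases "A = {}")
    case True
    then show ?thesis using peel.rest[of "{}"] by simp
  next
    case False
    then obtain x where x: "x \<in> A" by blast
    have "A \<noteq> {x}" using less.prems by auto
    then obtain y where y: "y \<in> A" "y \<noteq> x" using x by blast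
    let ?B = "A - {x, y}"
    have A: "A = insert x (insert y ?B)" using x y by auto
    have card: "card A = card ?B + 2"
      using less.prems(1) y by (subst A) (auto simp del: insert_Diff_single)
    have "peel ?B 0 (card ?B div 2) {}"
      using less.prems card by (intro less.hyps) auto
    then have "peel (insert x (insert y ?B)) 0 (Suc (card ?B div 2)) {}"
      using x y less.prems(3) by (intro peel.pair) auto
    then show ?thesis using A card by simp
  qed
qed

lemma fits_pair: "finite A \<Longrightarrow> sum W A \<le> D \<Longrightarrow> x \<in> A \<Longrightarrow> y \<in> A \<Longrightarrow> x \<noteq> y \<Longrightarrow> W x + W y \<le> D"
  using sum_mono2[of A "{x, y}" W] by simp

lemma peel_two_odd:
  assumes A: "finite A" "odd (card A)" "3 \<le> card A" "sum W A \<le> D"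
    and B: "finite B" "odd (card B)" "3 \<le> card B" "sum W B \<le> D" and "A \<inter> B = {}"
  shows "peel (A \<union> B) 0 ((card A + card B) div 2) {}"
proof -
  \<comment> \<open>The smallest item shares its bin with another item that is at least as large, so
    twice its size fits.\<close>
  have half: "\<exists>x\<in>S. 2 * W x \<le> D" if S: "finite S" "3 \<le> card S" "sum W S \<le> D" for S
  proof -
    define x where "x = arg_min_on W S"
    have "S \<noteq> {}" using S by auto
    then have x: "x \<in> S" "\<And>y. y \<in> S \<Longrightarrow> W x \<le> W y"
      unfolding x_def using S(1) by (auto simp: arg_min_if_finite arg_min_least)
    have "S \<noteq> {x}" using S by auto
    then obtain y where "y \<in> S" "y \<noteq> x" using x(1) by blast
    then have "2 * W x \<le> D" using fits_pair[OF S(1,3) x(1), of y] x(2)[of y] by simp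
    then show ?thesis using x by blast
  qed
  from half A obtain x where x: "x \<in> A" "2 * W x \<le> D" by blast
  from half B obtain y where y: "y \<in> B" "2 * W y \<le> D" by blast
  let ?A = "A - {x}" and ?B = "B - {y}"
  have card: "card A = Suc (card ?A)" "card B = Suc (card ?B)"
    using card.remove[OF A(1) x(1)] card.remove[OF B(1) y(1)] by simp_all
  have "peel ?A 0 (card ?A div 2) {}" "peel ?B 0 (card ?B div 2) {}"
    using A B card fits_pair[of A] fits_pair[of B] by (intro peel_even; auto)+
  then have "peel (?A \<union> ?B) (0 + 0) (card ?A div 2 + card ?B div 2) {}"
    using assms by (intro peel_union) auto
  then have "peel (insert x (insert y (?A \<union> ?B))) 0 (Suc (card ?A div 2 + card ?B div 2)) {}"
    using x y assms by (intro peel.pair) auto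
  moreover have "insert x (insert y (?A \<union> ?B)) = A \<union> B" using x y by auto
  moreover have "Suc (card ?A div 2 + card ?B div 2) = (card A + card B) div 2"
    using A(2) B(2) card by auto
  ultimately show ?thesis by simp
qed

text \<open>The second assumption is \<open>F(2) \<le> F(j)\<close>, cross-multiplied. In the
  induction over the bins, \<open>R\<close> is the one odd bin with at least three items that is
  waiting for a partner: the next such bin is pooled with it into pairs, which empties
  \<open>R\<close>.\<close>

lemma normal_form:
  assumes C: "C 0 = 0" "\<And>j. 1 \<le> j \<Longrightarrow> j \<le> n \<Longrightarrow> C 2 * j \<le> 2 * C j"
  shows "finite P \<Longrightarrow> disjoint P \<Longrightarrow>
    (\<And>B. B \<in> P \<Longrightarrow> finite B \<and> 1 \<le> card B \<and> card B \<le> n \<and> sum W B \<le> D) \<Longrightarrow>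
    \<exists>p m R. peel (\<Union>P) p m R \<and> sum W R \<le> D \<and> (R = {} \<or> odd (card R) \<and> 3 \<le> card R \<and> card R \<le> n) \<and>
      p * C 1 + m * C 2 + C (card R) \<le> (\<Sum>B\<in>P. C (card B))"
proof (induction rule: finite_induct)
  case empty
  show ?case using peel.rest[of "{}"] C by (intro exI[of _ 0] exI[of _ "{}"]) auto
next
  case (insert B P)
  have disj: "disjoint P" and BP: "B \<inter> \<Union>P = {}"
    using insert.prems(1) insert.hyps by (auto simp: disjoint_def)
  from insert.IH[OF disj] insert.prems(2) obtain p m R where
    peel: "peel (\<Union>P) p m R" and R: "sum W R \<le> D" "R = {} \<or> odd (card R) \<and> 3 \<le> card R \<and> card R \<le> n"
    and cost: "p * C 1 + m * C 2 + C (card R) \<le> (\<Sum>B\<in>P. C (card B))" by auto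
  have B: "finite B" "1 \<le> card B" "card B \<le> n" "sum W B \<le> D" using insert.prems(2) by auto
  have CB: "C 2 * card B \<le> 2 * C (card B)" using C(2) B by simp
  have RB: "R \<inter> B = {}" using peel_subset[OF peel] BP by auto
  have U: "\<Union>(insert B P) = \<Union>P \<union> B" by auto
  have sum: "(\<Sum>B\<in>insert B P. C (card B)) = (\<Sum>B\<in>P. C (card B)) + C (card B)"
    using insert.hyps by simp
  consider "even (card B)" | "card B = 1" | "odd (card B)" "3 \<le> card B"
    using B by (cases "even (card B)"; cases "card B = 1"; cases "card B = 2") auto
  then show ?case
  proof cases
    case 1
    then have "peel B 0 (card B div 2) {}" using B fits_pair by (intro peel_even) auto
    then have "peel (\<Union>P \<union> B) (p + 0) (m + card B div 2) R" using BP by (intro peel_union peel) auto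
    moreover have "card B div 2 * C 2 \<le> C (card B)" using CB 1 by (auto elim!: evenE simp: mult.commute)
    ultimately show ?thesis unfolding sum U using cost R
      by (intro exI[of _ "p + 0"] exI[of _ "m + card B div 2"] exI[of _ R])
        (auto simp: add_mult_distrib)
  next
    case 2
    then obtain x where x: "B = {x}" by (auto simp: card_1_singleton_iff)
    then have "peel (insert x (\<Union>P)) (Suc p) m R" using BP by (intro peel.single peel) auto
    then show ?thesis unfolding sum U using x cost R
      by (intro exI[of _ "Suc p"] exI[of _ m] exI[of _ R]) auto
  next
    case 3
    show ?thesis
    proof (cases "R = {}")
      case True
      then have "peel (\<Union>P \<union> B) p m B" using peel_weaken[OF peel, of B] BP by auto
      then show ?thesis unfolding sum U using 3 B cost True C(1)
        by (intro exI[of _ p] exI[of _ m] exI[of _ B]) auto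
    next
      case False
      then have R': "odd (card R)" "3 \<le> card R" "card R \<le> n" using R by auto
      then have "finite R" using card_ge_0_finite[of R] by simp
      then have "peel (R \<union> B) 0 ((card R + card B) div 2) {}"
        using R R' B 3 RB by (intro peel_two_odd) auto
      then have "peel (\<Union>P \<union> B) (p + 0) (m + (card R + card B) div 2) {}"
        using peel_weaken[OF peel, of B] BP peel_trans by blast
      moreover have "(card R + card B) div 2 * C 2 \<le> C (card R) + C (card B)"
      proof -
        have "C 2 * card R \<le> 2 * C (card R)" using C(2) R' by simp
        moreover have "2 * ((card R + card B) div 2) = card R + card B" using R' 3 by auto
        then have "2 * ((card R + card B) div 2 * C 2) = (card R + card B) * C 2"
          by (simp flip: mult.assoc)
        ultimately show ?thesis using CB by (simp add: algebra_simps)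
      qed
      ultimately show ?thesis unfolding sum U using cost C(1)
        by (intro exI[of _ "p + 0"] exI[of _ "m + (card R + card B) div 2"] exI[of _ "{}"])
          (auto simp: add_mult_distrib)
    qed
  qed
qed

text \<open>Turns an arbitrary packing into a guess \<open>(e, p, m)\<close> that costs no more. The
  large bin gets whatever the singles and pairs leave, hence the argument
  \<open>n - p - 2 * m\<close>.\<close>

lemma exists_completable:
  assumes n: "1 \<le> n" and W: "\<And>i. i \<in> {1..n} \<Longrightarrow> W i \<le> D"
    and C: "C 0 = 0" "\<And>j. 1 \<le> j \<Longrightarrow> j \<le> n \<Longrightarrow> C 2 * j \<le> 2 * C j"
    and P: "partition_on {1..n} P" "\<And>B. B \<in> P \<Longrightarrow> sum W B \<le> D"
  shows "\<exists>e p m. e \<in> {1..n} \<and> p + 2 * m < n \<and> completable e ({1..n} - {e}) p m \<and>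
    p * C 1 + m * C 2 + C (n - p - 2 * m) \<le> (\<Sum>B\<in>P. C (card B))"
proof -
  have UP: "\<Union>P = {1..n}" and disj: "disjoint P" and ne: "{} \<notin> P"
    using P(1) by (auto simp: partition_on_def)
  have "finite P" using UP by (metis finite_UnionD finite_atLeastAtMost)
  moreover have "finite B \<and> 1 \<le> card B \<and> card B \<le> n \<and> sum W B \<le> D" if "B \<in> P" for B
  proof -
    have "B \<subseteq> {1..n}" using that UP by auto
    then have "finite B" "card B \<le> n" using finite_subset card_mono[of "{1..n}" B] by auto
    then show ?thesis using P(2) that ne by (auto simp: Suc_le_eq card_gt_0_iff)
  qed
  ultimately obtain p m R where
    pR: "peel {1..n} p m R" and R: "sum W R \<le> D"
    and cost: "p * C 1 + m * C 2 + C (card R) \<le> (\<Sum>B\<in>P. C (card B))"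
    using normal_form[of C n P, OF C _ disj] UP by auto
  \<comment> \<open>A guess of \<open>e\<close> presupposes a nonempty large bin. If only singles
    and pairs occur, one of them is declared to be the large bin, at unchanged cost.\<close>
  obtain p m R where
    pR: "peel {1..n} p m R" and R: "sum W R \<le> D" "R \<noteq> {}"
    and cost: "p * C 1 + m * C 2 + C (card R) \<le> (\<Sum>B\<in>P. C (card B))"
  proof (cases "R = {}")
    case False
    with that pR R cost show ?thesis by blast
  next
    case Re: True
    show ?thesis
    proof (cases p)
      case (Suc p')
      from peel_singleE[OF pR Suc] obtain x where x: "x \<in> {1..n}" "peel ({1..n} - {x}) p' m {}"
        using Re by blast
      then have "peel ({1..n} - {x} \<union> {x}) p' m ({} \<union> {x})" by (intro peel_weaken) auto
      moreover have "{1..n} - {x} \<union> {x} = {1..n}" using x by auto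
      ultimately have "peel {1..n} p' m {x}" by simp
      then show ?thesis using x W cost Suc Re C(1) by (intro that) auto
    next
      case 0
      have "m \<noteq> 0" using peel_card[OF pR] 0 Re n by auto
      then obtain m' where m': "m = Suc m'" by (cases m) auto
      from pR 0 m' Re obtain x y where xy: "x \<in> {1..n}" "y \<in> {1..n}" "x \<noteq> y" "W x + W y \<le> D"
        "peel ({1..n} - {x, y}) 0 m' {}" by (metis peel_pairE)
      then have "peel ({1..n} - {x, y} \<union> {x, y}) 0 m' ({} \<union> {x, y})" by (intro peel_weaken) auto
      moreover have "{1..n} - {x, y} \<union> {x, y} = {1..n}" using xy by auto
      ultimately have "peel {1..n} 0 m' {x, y}" by simp
      moreover have "card {x, y} = 2" using xy by simp
      ultimately show ?thesis using xy cost m' 0 Re C(1)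
        by (intro that[of 0 m' "{x, y}"]) (auto simp: numeral_2_eq_2)
    qed
  qed
  have fR: "finite R" using peel_subset[OF pR] finite_subset by blast
  have card: "n = p + 2 * m + card R" using peel_card[OF pR] by simp
  have "Max (W ` R) \<in> W ` R" using fR R(2) by (intro Max_in) auto
  then obtain e where e: "e \<in> R" "W e = Max (W ` R)" by auto
  then have max: "W i \<le> W e" if "i \<in> R" for i using that fR by simp
  have "e \<in> {1..n}" using e peel_subset[OF pR] by auto
  moreover have "completable e ({1..n} - {e}) p m"
    unfolding completable_def using peel_remove_rest[OF pR e(1)] R e(1) max fR
    by (auto intro!: exI[of _ "R - {e}"] simp: sum.remove[of R e])
  moreover have "0 < card R" using R(2) fR by (simp add: card_gt_0_iff)
  moreover have "n - p - 2 * m = card R" using card by simp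
  ultimately show ?thesis using cost card by (metis less_add_same_cancel1)
qed

end

section \<open>Labellings\<close>

definition labelled :: "nat \<Rightarrow> (nat \<Rightarrow> nat) \<Rightarrow> nat \<Rightarrow> nat set" where
  "labelled n lab k = {i \<in> {1..n}. lab i = k}"

definition feasible_labelling :: "nat \<Rightarrow> (nat \<Rightarrow> nat) \<Rightarrow> nat \<Rightarrow> (nat \<Rightarrow> nat) \<Rightarrow> bool" where
  "feasible_labelling n W D lab \<longleftrightarrow> (\<forall>k\<in>{1..n}. sum W (labelled n lab k) \<le> D)"

definition labelling_cost :: "nat \<Rightarrow> (nat \<Rightarrow> nat) \<Rightarrow> (nat \<Rightarrow> nat) \<Rightarrow> nat" where
  "labelling_cost n C lab = (\<Sum>k = 1..n. C (card (labelled n lab k)))"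

lemma finite_labelled [simp]: "finite (labelled n lab k)"
  by (simp add: labelled_def)

lemma labelled_cong: "(\<And>i. i \<in> {1..n} \<Longrightarrow> lab i = lab' i) \<Longrightarrow> labelled n lab = labelled n lab'"
  by (auto simp: labelled_def fun_eq_iff)

lemma labelling_cost_cong:
  "(\<And>i. i \<in> {1..n} \<Longrightarrow> lab i = lab' i) \<Longrightarrow> labelling_cost n C lab = labelling_cost n C lab'"
  using labelled_cong[of n lab lab'] by (simp add: labelling_cost_def)

lemma feasible_labelling_cong:
  "(\<And>i. i \<in> {1..n} \<Longrightarrow> lab i = lab' i) \<Longrightarrow>
    feasible_labelling n W D lab = feasible_labelling n W D lab'"
  using labelled_cong[of n lab lab'] by (simp add: feasible_labelling_def)

lemma sum_card_labelled:
  assumes "\<And>i. i \<in> {1..n} \<Longrightarrow> lab i \<in> {1..n}"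
  shows "(\<Sum>k = 1..n. card (labelled n lab k)) = n"
proof -
  have "(\<Sum>k = 1..n. card (labelled n lab k)) = card (\<Union>k\<in>{1..n}. labelled n lab k)"
    by (rule card_UN_disjoint[symmetric]) (auto simp: labelled_def)
  also have "(\<Union>k\<in>{1..n}. labelled n lab k) = {1..n}"
    unfolding labelled_def using assms by blast
  finally show ?thesis by simp
qed

subsection \<open>The greedy packing\<close>

text \<open>
  State before round \<open>k\<close>: label \<open>0\<close> means unassigned, the rounds up to \<open>p\<close> have produced single
  items and the later ones pairs, and the label \<open>n\<close> is reserved for the bin of the item \<open>e\<close>.
\<close>

definition greedy_inv ::
    "nat \<Rightarrow> (nat \<Rightarrow> nat) \<Rightarrow> nat \<Rightarrow> nat \<Rightarrow> nat \<Rightarrow> nat \<Rightarrow> nat \<Rightarrow> (nat \<Rightarrow> nat) \<Rightarrow> bool" where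
  "greedy_inv n W D e p m k lab \<longleftrightarrow>
     (\<forall>j. 1 \<le> j \<and> j < k \<longrightarrow>
        card (labelled n lab j) = (if j \<le> p then 1 else 2) \<and> sum W (labelled n lab j) \<le> D) \<and>
     labelled n lab n = {e} \<and> (\<forall>i\<in>{1..n}. lab i < k \<or> lab i = n) \<and>
     completable W D e (labelled n lab 0) (p - (k - 1)) (m - (k - 1 - p))"

lemma greedy_inv_init:
  assumes "\<And>i. i \<in> {1..n} \<Longrightarrow> lab i = 0" "e \<in> {1..n}" "completable W D e ({1..n} - {e}) p m"
  shows "greedy_inv n W D e p m 1 (lab(e := n))"
proof -
  have "(lab(e := n)) i = n \<longleftrightarrow> i = e" "(lab(e := n)) i = 0 \<longleftrightarrow> i \<noteq> e" if "i \<in> {1..n}" for i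
    using assms(1)[OF that] that by auto
  then have "labelled n (lab(e := n)) n = {e}" "labelled n (lab(e := n)) 0 = {1..n} - {e}"
    unfolding labelled_def using assms(2) by blast+
  then show ?thesis using assms(1,3) unfolding greedy_inv_def by auto
qed

lemma greedy_inv_single:
  assumes inv: "greedy_inv n W D e p m k lab" and k: "1 \<le> k" "k \<le> p" "p < n"
    and t: "t \<in> labelled n lab 0" "\<And>i. i \<in> labelled n lab 0 \<Longrightarrow> W i \<le> W t" and "W t \<le> D"
  shows "greedy_inv n W D e p m (Suc k) (lab(t := k))"
proof -
  have "labelled n lab k = {}" using inv k by (auto simp: greedy_inv_def labelled_def)
  then have lk: "labelled n (lab(t := k)) k = {t}" using t by (auto simp: labelled_def)
  have l0: "labelled n (lab(t := k)) 0 = labelled n lab 0 - {t}"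
    using t k by (auto simp: labelled_def)
  have lj: "labelled n (lab(t := k)) j = labelled n lab j" if "j \<noteq> k" "j \<noteq> 0" for j
    using t that by (auto simp: labelled_def)
  have "completable W D e (labelled n lab 0) (Suc (p - k)) m"
    using inv k by (simp add: greedy_inv_def Suc_diff_le[symmetric])
  then have "completable W D e (labelled n lab 0 - {t}) (p - k) m"
    using t by (rule completable_single)
  then show ?thesis using inv k lk lj \<open>W t \<le> D\<close>
    unfolding greedy_inv_def l0 by (auto simp: less_Suc_eq)
qed

lemma greedy_inv_pair:
  assumes inv: "greedy_inv n W D e p m k lab" and k: "p < k" "k \<le> p + m" "p + m < n"
    and t: "t \<in> labelled n lab 0" "\<And>i. i \<in> labelled n lab 0 \<Longrightarrow> W i \<le> W t"
    and u: "u \<in> labelled n lab 0 - {t}" "W t + W u \<le> D"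
      "\<And>i. i \<in> labelled n lab 0 - {t} \<Longrightarrow> W t + W i \<le> D \<Longrightarrow> W i \<le> W u"
  shows "greedy_inv n W D e p m (Suc k) (lab(t := k, u := k))"
proof -
  let ?lab = "lab(t := k, u := k)"
  have "labelled n lab k = {}" using inv k by (auto simp: greedy_inv_def labelled_def)
  then have lk: "labelled n ?lab k = {t, u}" using t u by (auto simp: labelled_def)
  have l0: "labelled n ?lab 0 = labelled n lab 0 - {t, u}"
    using t k by (auto simp: labelled_def)
  have lj: "labelled n ?lab j = labelled n lab j" if "j \<noteq> k" "j \<noteq> 0" for j
    using t u that by (auto simp: labelled_def)
  have "m - (k - 1 - p) = Suc (m - (k - p))" using k by linarith
  then have "completable W D e (labelled n lab 0) 0 (Suc (m - (k - p)))"
    using inv k by (simp add: greedy_inv_def)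
  then have "completable W D e (labelled n lab 0 - {t, u}) 0 (m - (k - p))"
    using t u(1,3) by (rule completable_pair)
  moreover have "t \<noteq> u" using u by auto
  ultimately show ?thesis using inv k lk lj u(2)
    unfolding greedy_inv_def l0 by (auto simp: less_Suc_eq)
qed

text \<open>Serves twice: with the identity for \<open>g\<close> it counts the items and so
  determines the size of bin \<open>n\<close>; with the cost function it gives the cost of the
  packing.\<close>

lemma sum_greedy_labels:
  fixes g :: "nat \<Rightarrow> nat"
  assumes "p + m < n" "\<And>j. 1 \<le> j \<Longrightarrow> j \<le> p \<Longrightarrow> x j = a" "\<And>j. p < j \<Longrightarrow> j \<le> p + m \<Longrightarrow> x j = b"
    "\<And>j. p + m < j \<Longrightarrow> j < n \<Longrightarrow> x j = 0" "g 0 = 0"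
  shows "(\<Sum>j = 1..n. g (x j)) = p * g a + m * g b + g (x n)"
proof -
  have "{1..n} = {1..p} \<union> {p<..p + m} \<union> {p + m<..<n} \<union> {n}" using assms(1) by auto
  then have "(\<Sum>j = 1..n. g (x j)) = (\<Sum>j\<in>{1..p} \<union> {p<..p + m} \<union> {p + m<..<n} \<union> {n}. g (x j))"
    by (rule arg_cong)
  also have "\<dots> = (\<Sum>j = 1..p. g (x j)) + (\<Sum>j\<in>{p<..p + m}. g (x j))
      + (\<Sum>j\<in>{p + m<..<n}. g (x j)) + g (x n)"
    using assms(1) by ((subst sum.union_disjoint, simp, simp, force)+, simp)
  also have "\<dots> = p * g a + m * g b + 0 + g (x n)"
    using assms(2-5) by simp
  finally show ?thesis by simp
qed

lemma greedy_inv_final: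
  assumes inv: "greedy_inv n W D e p m (Suc (p + m)) lab" and n: "p + 2 * m < n" and C: "C 0 = 0"
    and lab': "\<And>i. i \<in> {1..n} \<Longrightarrow> lab' i = (if lab i = 0 then n else lab i)"
  shows "feasible_labelling n W D lab'"
    "labelling_cost n C lab' = p * C 1 + m * C 2 + C (n - p - 2 * m)"
proof -
  have "lab' i = n \<longleftrightarrow> lab i = 0 \<or> lab i = n" if "i \<in> {1..n}" for i
    using lab'[OF that] by auto
  then have "labelled n lab' n = labelled n lab 0 \<union> labelled n lab n"
    unfolding labelled_def by blast
  then have ln: "labelled n lab' n = insert e (labelled n lab 0)"
    using inv by (simp add: greedy_inv_def)
  have lj: "labelled n lab' j = labelled n lab j" if "1 \<le> j" "j \<le> p + m" for j
  proof -
    have "lab' i = j \<longleftrightarrow> lab i = j" if "i \<in> {1..n}" for i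
      using lab'[OF that] n \<open>1 \<le> j\<close> \<open>j \<le> p + m\<close> by auto
    then show ?thesis unfolding labelled_def by blast
  qed
  have le: "labelled n lab' j = {}" if "p + m < j" "j < n" for j
  proof -
    have "lab' i \<noteq> j" if i: "i \<in> {1..n}" for i
    proof -
      have "lab i < Suc (p + m) \<or> lab i = n" using inv i by (simp add: greedy_inv_def)
      then show ?thesis using lab'[OF i] \<open>p + m < j\<close> \<open>j < n\<close> by auto
    qed
    then show ?thesis unfolding labelled_def by blast
  qed
  \<comment> \<open>With no single or pair left to remove, the rest is the whole set of unassigned
    items, so all of them fit beside \<open>e\<close>.\<close>
  have "completable W D e (labelled n lab 0) 0 0"
    using inv by (simp add: greedy_inv_def)
  then obtain R where "peel W D (labelled n lab 0) 0 0 R" "W e + sum W R \<le> D" "e \<notin> labelled n lab 0"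
    by (auto simp: completable_def)
  then have sn: "sum W (labelled n lab' n) \<le> D"
    using ln by (auto elim!: peel.cases)
  show "feasible_labelling n W D lab'"
    unfolding feasible_labelling_def
  proof
    fix k assume k: "k \<in> {1..n}"
    consider "k \<le> p + m" | "p + m < k" "k < n" | "k = n" using k by fastforce
    then show "sum W (labelled n lab' k) \<le> D"
    proof cases
      case 1
      then show ?thesis using lj[of k] k inv by (simp add: greedy_inv_def)
    next
      case 2
      then show ?thesis using le by simp
    qed (use sn in simp)
  qed
  let ?x = "\<lambda>j. card (labelled n lab' j)"
  have x: "?x j = 1" if "1 \<le> j" "j \<le> p" for j
    using lj[of j] inv that by (simp add: greedy_inv_def)
  have y: "?x j = 2" if "p < j" "j \<le> p + m" for j
    using lj[of j] inv that by (simp add: greedy_inv_def)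
  have z: "?x j = 0" if "p + m < j" "j < n" for j
    using le that by simp
  have pm: "p + m < n" using n by simp
  have "lab' i \<in> {1..n}" if "i \<in> {1..n}" for i
  proof -
    have "lab i < Suc (p + m) \<or> lab i = n" using inv that by (simp add: greedy_inv_def)
    then show ?thesis using lab'[OF that] pm by auto
  qed
  then have "n = (\<Sum>j = 1..n. ?x j)" using sum_card_labelled by metis
  also have "\<dots> = p * 1 + m * 2 + ?x n"
    by (rule sum_greedy_labels[where g = "\<lambda>x. x", OF pm x y z]) auto
  finally have xn: "?x n = n - p - 2 * m" by simp
  show "labelling_cost n C lab' = p * C 1 + m * C 2 + C (n - p - 2 * m)"
    unfolding labelling_cost_def xn[symmetric]
    by (rule sum_greedy_labels[where x = ?x and a = 1 and b = 2 and g = C, OF pm x y z C])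
qed

section \<open>The program\<close>

abbreviation entry :: "vname \<Rightarrow> vname \<Rightarrow> aexp" where
  "entry x i \<equiv> Arr x (scalar i)"

abbreviation LSet :: "vname \<Rightarrow> aexp \<Rightarrow> lcom" where
  "LSet x a \<equiv> LAssign x (Lit 0) a"

text \<open>Dividing before multiplying keeps the right factor an input entry, as
  \<open>slow\<close> demands; the division is exact since \<open>d\<close> is the product of all
  denominators. Cell 0 of the target array keeps its initial value 0, which is correct for
  \<open>f(0) = 0\<close> and provides the zero in \<open>w[0]\<close> that \<open>pick\<close>
  relies on.\<close>

definition scale :: "vname \<Rightarrow> vname \<Rightarrow> vname \<Rightarrow> vname \<Rightarrow> lcom" where
  "scale d x num den' =
     LSet d (Lit 1);;
     LFor ''i'' (LSet d (Mul (scalar d) (entry den' ''i'')));;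
     LFor ''i'' (LAssign x (scalar ''i'') (Mul (Div (scalar d) (entry den' ''i'')) (entry num ''i'')))"

text \<open>
  The largest unassigned item of size at most \<open>cap\<close>, or \<open>0\<close> if there is none.  The cell \<open>w[0]\<close>
  is never written, so the comparison with \<open>w[t]\<close> succeeds while \<open>t = 0\<close>.
\<close>

definition pick :: lcom where
  "pick =
     LSet ''t'' (Lit 0);;
     LFor ''i'' (LIf (BAnd (BLess (entry ''lab'' ''i'') (Lit 1))
                     (BAnd (BNot (BLess (scalar ''cap'') (entry ''w'' ''i'')))
                           (BNot (BLess (entry ''w'' ''i'') (entry ''w'' ''t'')))))
                  (LSet ''t'' (scalar ''i'')) LSkip)"

text \<open>Loop counters start at 1, so the cells \<open>p\<close> and \<open>m\<close> hold one
  more than the guessed numbers. In terms of the latter the tests read \<open>k \<le> p + m\<close>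
  and \<open>k \<le> p\<close>. If \<open>pick\<close> finds nothing, the label goes to cell 0,
  which belongs to no item.\<close>

definition greedy_round :: lcom where
  "greedy_round =
     LIf (BLess (Add (scalar ''k'') (Lit 1)) (Add (scalar ''p'') (scalar ''m'')))
       (LSet ''cap'' (scalar ''D'');; pick;; LAssign ''lab'' (scalar ''t'') (scalar ''k'');;
        LIf (BLess (scalar ''k'') (scalar ''p'')) LSkip
          (LSet ''cap'' (Sub (scalar ''D'') (entry ''w'' ''t''));; pick;;
           LAssign ''lab'' (scalar ''t'') (scalar ''k'')))
       LSkip"

text \<open>The last loop puts all leftovers into the bin of \<open>e\<close>. Every guess thus
  yields a complete labelling, possibly an infeasible one.\<close>

definition trial :: lcom where
  "trial =
     LFor ''i'' (LAssign ''lab'' (scalar ''i'') (Lit 0));;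
     LAssign ''lab'' (scalar ''e'') (scalar ''n'');;
     LFor ''k'' greedy_round;;
     LFor ''i'' (LIf (BLess (entry ''lab'' ''i'') (Lit 1))
                  (LAssign ''lab'' (scalar ''i'') (scalar ''n'')) LSkip)"

definition measure_bin :: lcom where
  "measure_bin =
     LSet ''cnt'' (Lit 0);; LSet ''sum'' (Lit 0);;
     LFor ''i'' (LIf (BAnd (BNot (BLess (entry ''lab'' ''i'') (scalar ''k'')))
                           (BNot (BLess (scalar ''k'') (entry ''lab'' ''i''))))
                  (LSet ''cnt'' (Add (scalar ''cnt'') (Lit 1));;
                   LSet ''sum'' (Add (scalar ''sum'') (entry ''w'' ''i'')))
                  LSkip)"

definition evaluate :: lcom where
  "evaluate =
     LSet ''bad'' (Lit 0);; LSet ''cost'' (Lit 0);;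
     LFor ''k'' (measure_bin;;
       LIf (BLess (scalar ''D'') (scalar ''sum'')) (LSet ''bad'' (Lit 1)) LSkip;;
       LSet ''cost'' (Add (scalar ''cost'') (entry ''c'' ''cnt'')))"

definition update :: lcom where
  "update =
     LIf (BAnd (BLess (scalar ''bad'') (Lit 1)) (BLess (scalar ''cost'') (scalar ''best'')))
       (LSet ''best'' (scalar ''cost'');;
        LFor ''i'' (LAssign ''bin'' (scalar ''i'') (entry ''lab'' ''i'')))
       LSkip"

text \<open>The search starts from the packing with one item per bin. It is feasible and costs
  \<open>E * n\<close>, because \<open>f(1) = 1\<close> is scaled to \<open>E\<close>.\<close>

definition solver :: lcom where
  "solver =
     scale ''D'' ''w'' ''s_num'' ''s_den'';;
     scale ''E'' ''c'' ''f_num'' ''f_den'';;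
     LSet ''best'' (Mul (scalar ''E'') (scalar ''n''));;
     LFor ''i'' (LAssign ''bin'' (scalar ''i'') (scalar ''i''));;
     LFor ''e'' (LFor ''p'' (LFor ''m'' (trial;; evaluate;; update)))"

lemmas program_defs = scale_def pick_def greedy_round_def trial_def measure_bin_def evaluate_def
  update_def solver_def

lemma wf_solver: "wf_prog solver"
  by (simp add: program_defs inputs_def)

text \<open>An invariant rule in the style of Hoare logic. \<open>I i\<close> describes the state
  before the counter is set to \<open>i\<close>, so the last write to the counter is dealt with
  separately in the premise for \<open>Q\<close>.\<close>

lemma den_LForI:
  assumes "s ''n'' 0 = N" "I 1 s"
    and "\<And>i u. 1 \<le> i \<Longrightarrow> i \<le> N \<Longrightarrow> I i u \<Longrightarrow> I (Suc i) (den c (upd v 0 i u))"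
    and "\<And>u. I (Suc N) u \<Longrightarrow> Q (upd v 0 (Suc N) u)"
  shows "Q (den (LFor v c) s)"
proof -
  have "k \<le> N \<Longrightarrow> I (Suc k) (fold (\<lambda>i u. den c (upd v 0 i u)) [1..<Suc k] s)" for k
    using assms(2,3) by (induction k) (auto simp: less_Suc_eq_le)
  from this[of N] show ?thesis using assms(1,4) by (simp del: upt_Suc)
qed

section \<open>Correctness of the subprograms\<close>

lemma scale_correct:
  assumes d: "distinct [d, x, num, den', ''i'', ''n'']" and n: "s ''n'' 0 = n"
  defines "t \<equiv> den (scale d x num den') s" and "T \<equiv> (\<Prod>i = 1..n. s den' i)"
  shows "t d 0 = T"
    "t x i = (if i \<in> {1..n} then T div s den' i * s num i else s x i)"
proof -
  define s0 where "s0 = den (LSet d (Lit 1)) s"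
  define s1 where "s1 = den (LFor ''i'' (LSet d (Mul (scalar d) (entry den' ''i'')))) s0"
  let ?Q1 = "\<lambda>u. u d 0 = T \<and> u ''n'' 0 = n \<and> u x = s x \<and> u num = s num \<and> u den' = s den'"
  have s1: "?Q1 s1"
    unfolding s1_def
  proof (rule den_LForI[where N = n and I = "\<lambda>i u. u d 0 = (\<Prod>j = 1..<i. s den' j) \<and>
      u ''n'' 0 = n \<and> u x = s x \<and> u num = s num \<and> u den' = s den'"], goal_cases)
    case (4 u)
    then show ?case using d by (auto simp: T_def atLeastLessThanSuc_atLeastAtMost)
  qed (use d n in \<open>auto simp: s0_def\<close>)
  let ?Q2 = "\<lambda>u. u d 0 = T \<and> (\<forall>i. u x i = (if i \<in> {1..n} then T div s den' i * s num i else s x i))"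
  have "?Q2 (den (LFor ''i'' (LAssign x (scalar ''i'')
      (Mul (Div (scalar d) (entry den' ''i'')) (entry num ''i'')))) s1)"
  proof (rule den_LForI[where N = n and I = "\<lambda>i u. u d 0 = T \<and> u num = s num \<and> u den' = s den' \<and>
      (\<forall>j. u x j = (if j \<in> {1..<i} then T div s den' j * s num j else s x j))"], goal_cases)
    case (4 u)
    then show ?case using d by (auto simp: atLeastLessThanSuc_atLeastAtMost)
  qed (use d s1 in \<open>auto simp: less_Suc_eq\<close>)
  then show "t d 0 = T" "t x i = (if i \<in> {1..n} then T div s den' i * s num i else s x i)"
    by (simp_all add: t_def scale_def s1_def s0_def)
qed

lemma pick_correct:
  assumes n: "s ''n'' 0 = n" and w: "s ''w'' 0 = 0"
  defines "t \<equiv> den pick s ''t'' 0"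
    and "S \<equiv> {i \<in> labelled n (s ''lab'') 0. s ''w'' i \<le> s ''cap'' 0}"
  shows "t = 0 \<and> S = {} \<or> t \<in> S \<and> (\<forall>i\<in>S. s ''w'' i \<le> s ''w'' t)"
proof -
  let ?R = "\<lambda>i u. let t = u ''t'' 0 in
    t = 0 \<and> S \<inter> {..<i} = {} \<or> t \<in> S \<inter> {..<i} \<and> (\<forall>j\<in>S \<inter> {..<i}. s ''w'' j \<le> s ''w'' t)"
  have S: "S \<inter> {..<Suc n} = S" "0 \<notin> S" by (auto simp: S_def labelled_def)
  have "let t = den pick s ''t'' 0 in
    t = 0 \<and> S = {} \<or> t \<in> S \<and> (\<forall>i\<in>S. s ''w'' i \<le> s ''w'' t)"
    unfolding pick_def den.simps(3)
  proof (rule den_LForI[where N = n and I = "\<lambda>i u. u ''lab'' = s ''lab'' \<and> u ''w'' = s ''w'' \<and>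
      u ''cap'' 0 = s ''cap'' 0 \<and> ?R i u"], goal_cases)
    case 2
    then show ?case using S by (auto simp: Let_def less_Suc_eq)
  next
    case (3 i u)
    have iS: "i \<in> S \<longleftrightarrow> s ''lab'' i = 0 \<and> s ''w'' i \<le> s ''cap'' 0"
      using 3 by (auto simp: S_def labelled_def)
    have lt: "S \<inter> {..<Suc i} = (if i \<in> S then insert i (S \<inter> {..<i}) else S \<inter> {..<i})"
      by (auto simp: less_Suc_eq)
    show ?case
      using 3 iS w unfolding Let_def lt
      by (auto simp: not_less) (meson IntI lessThan_iff le_trans)
  next
    case (4 u)
    then show ?case using S by (simp add: Let_def)
  qed (use n in simp)
  then show ?thesis by (simp add: t_def Let_def)
qed

lemma measure_bin_correct:
  assumes n: "s ''n'' 0 = n"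
  shows "den measure_bin s ''cnt'' 0 = card (labelled n (s ''lab'') (s ''k'' 0)) \<and>
    den measure_bin s ''sum'' 0 = sum (s ''w'') (labelled n (s ''lab'') (s ''k'' 0))"
proof -
  define S where "S = labelled n (s ''lab'') (s ''k'' 0)"
  have S: "S \<inter> {..<Suc n} = S" "0 \<notin> S" "finite S" by (auto simp: S_def labelled_def)
  show ?thesis
    unfolding measure_bin_def den.simps(3) S_def[symmetric]
  proof (rule den_LForI[where N = n and I = "\<lambda>i u. u ''lab'' = s ''lab'' \<and> u ''w'' = s ''w'' \<and>
      u ''k'' 0 = s ''k'' 0 \<and> u ''cnt'' 0 = card (S \<inter> {..<i}) \<and>
      u ''sum'' 0 = sum (s ''w'') (S \<inter> {..<i})"], goal_cases)
    case 2
    have "S \<inter> {..<1} = {}" using S by auto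
    then show ?case by simp
  next
    case (3 i u)
    have iS: "i \<in> S \<longleftrightarrow> s ''lab'' i = s ''k'' 0"
      using 3 by (auto simp: S_def labelled_def)
    have lt: "S \<inter> {..<Suc i} = (if i \<in> S then insert i (S \<inter> {..<i}) else S \<inter> {..<i})"
      by (auto simp: less_Suc_eq)
    show ?case using 3 iS S(3) unfolding lt by auto
  next
    case (4 u)
    then show ?case using S by simp
  qed (use n in simp)
qed

section \<open>Correctness of the search over all guesses\<close>

context
  fixes n D :: nat and W C :: "nat \<Rightarrow> nat"
begin

definition base :: "state \<Rightarrow> bool" where
  "base s \<longleftrightarrow> s ''n'' 0 = n \<and> s ''w'' = W \<and> s ''c'' = C \<and> s ''D'' 0 = D"

definition good :: "nat \<Rightarrow> nat \<Rightarrow> nat \<Rightarrow> bool" where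
  "good e p m \<longleftrightarrow> e \<in> {1..n} \<and> p + 2 * m < n \<and> completable W D e ({1..n} - {e}) p m"

text \<open>The loop over \<open>k\<close> always makes \<open>n\<close> rounds, but those after
  round \<open>p + m\<close> do nothing; \<open>min\<close> freezes the invariant there. The bound
  on the labels holds for wrong guesses too, so their bins are also seen by
  \<open>evaluate\<close>.\<close>

definition greedy_state :: "nat \<Rightarrow> nat \<Rightarrow> nat \<Rightarrow> nat \<Rightarrow> state \<Rightarrow> bool" where
  "greedy_state e p m k s \<longleftrightarrow> base s \<and> s ''p'' 0 = Suc p \<and> s ''m'' 0 = Suc m \<and>
     (\<forall>i\<in>{1..n}. s ''lab'' i \<le> n) \<and>
     (good e p m \<longrightarrow> greedy_inv n W D e p m (min k (Suc (p + m))) (s ''lab''))"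

text \<open>\<open>S\<close> collects the counter values tried so far, each one above the guessed
  number. The bound on \<open>best\<close> refers to the cost formula rather than to the labelling
  of that trial, so it survives when \<open>lab\<close> is overwritten.\<close>

definition search_state :: "(nat \<times> nat \<times> nat) set \<Rightarrow> state \<Rightarrow> bool" where
  "search_state S s \<longleftrightarrow> base s \<and> (\<forall>i\<in>{1..n}. s ''bin'' i \<in> {1..n}) \<and>
     feasible_labelling n W D (s ''bin'') \<and> s ''best'' 0 = labelling_cost n C (s ''bin'') \<and>
     (\<forall>(e, p, m)\<in>S. good e (p - 1) (m - 1) \<longrightarrow>
        s ''best'' 0 \<le> (p - 1) * C 1 + (m - 1) * C 2 + C (n - (p - 1) - 2 * (m - 1)))"

context
  assumes n_pos: "1 \<le> n" and W0: "W 0 = 0" and W_le: "\<And>i. i \<in> {1..n} \<Longrightarrow> W i \<le> D"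
    and C0: "C 0 = 0"
begin

lemma base_den: "base s \<Longrightarrow> {''n'', ''w'', ''c'', ''D''} \<inter> assigned c = {} \<Longrightarrow> base (den c s)"
  using den_frame[of _ c s] by (simp add: base_def)

lemma base_upd: "base s \<Longrightarrow> x \<notin> {''n'', ''w'', ''c'', ''D''} \<Longrightarrow> base (upd x i v s)"
  by (auto simp: base_def)

lemma evaluate_correct:
  assumes "base s"
  shows "(den evaluate s ''bad'' 0 = 0 \<longleftrightarrow> feasible_labelling n W D (s ''lab'')) \<and>
    den evaluate s ''cost'' 0 = labelling_cost n C (s ''lab'')"
  unfolding evaluate_def den.simps(3)
proof (rule den_LForI[where N = n and I = "\<lambda>k u. base u \<and> u ''lab'' = s ''lab'' \<and>
    (u ''bad'' 0 = 0 \<longleftrightarrow> (\<forall>j\<in>{1..<k}. sum W (labelled n (s ''lab'') j) \<le> D)) \<and>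
    u ''cost'' 0 = (\<Sum>j = 1..<k. C (card (labelled n (s ''lab'') j)))"], goal_cases)
  case (3 k u)
  define v where "v = den measure_bin (upd ''k'' 0 k u)"
  have bu: "base (upd ''k'' 0 k u)" using 3 by (intro base_upd) auto
  have bv: "base v" unfolding v_def using bu by (rule base_den) (simp add: measure_bin_def)
  have fr: "v ''lab'' = s ''lab''" "v ''bad'' = u ''bad''" "v ''cost'' = u ''cost''"
    using 3 den_frame[of _ measure_bin "upd ''k'' 0 k u"] by (auto simp: v_def measure_bin_def)
  have v: "v ''cnt'' 0 = card (labelled n (s ''lab'') k)" "v ''sum'' 0 = sum W (labelled n (s ''lab'') k)"
    using measure_bin_correct[of "upd ''k'' 0 k u" n] bu 3 by (auto simp: v_def base_def)
  show ?case
    using 3 bv fr v by (auto simp: base_def v_def[symmetric] atLeastLessThanSuc)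
qed (use assms in \<open>auto simp: base_def labelling_cost_def feasible_labelling_def
    atLeastLessThanSuc_atLeastAtMost\<close>)

lemma greedy_round_correct:
  assumes s: "greedy_state e p m k s" "s ''k'' 0 = k" and k: "1 \<le> k" "k \<le> n"
  shows "greedy_state e p m (Suc k) (den greedy_round s)"
proof (cases "k \<le> p + m")
  case False
  then show ?thesis using s by (simp add: greedy_round_def greedy_state_def)
next
  case km: True
  have pick_fr: "den pick u x = u x" if "x \<notin> {''t'', ''i''}" for u x
    using that by (intro den_frame) (simp add: pick_def)
  define s1 where "s1 = den pick (upd ''cap'' 0 D s)"
  define t where "t = s1 ''t'' 0"
  define s2 where "s2 = upd ''lab'' t k s1"
  have base: "base s" using s by (simp add: greedy_state_def)
  have s1: "base s1" "s1 ''p'' 0 = Suc p" "s1 ''m'' 0 = Suc m" "s1 ''lab'' = s ''lab''" "s1 ''k'' 0 = k"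
    using s by (simp_all add: s1_def base_def pick_fr greedy_state_def)
  then have s2: "base s2" "s2 ''p'' 0 = Suc p" "s2 ''m'' 0 = Suc m" "s2 ''lab'' = (s ''lab'')(t := k)"
    "s2 ''k'' 0 = k"
    by (auto simp: s2_def base_def)
  have lab_le: "\<forall>i\<in>{1..n}. s ''lab'' i \<le> n" using s by (simp add: greedy_state_def)
  let ?U = "labelled n (s ''lab'') 0"
  \<comment> \<open>Every item fits alone, so the cap \<open>D\<close> excludes nothing.\<close>
  have cand: "{i \<in> ?U. W i \<le> D} = ?U" using W_le by (auto simp: labelled_def)
  have t: "t = 0 \<and> ?U = {} \<or> t \<in> ?U \<and> (\<forall>i\<in>?U. W i \<le> W t)"
    using pick_correct[of "upd ''cap'' 0 D s" n] base W0
    by (subst (1 2 3) cand[symmetric]) (simp add: t_def s1_def base_def)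
  show ?thesis
  proof (cases "k \<le> p")
    case kp: True
    have "greedy_inv n W D e p m (Suc k) ((s ''lab'')(t := k))" if g: "good e p m"
    proof -
      have inv: "greedy_inv n W D e p m k (s ''lab'')" using s g km by (simp add: greedy_state_def)
      then have "completable W D e ?U (Suc (p - k)) m"
        using k kp by (simp add: greedy_inv_def Suc_diff_le[symmetric])
      then have "?U \<noteq> {}" using peel_singleE by (fastforce simp: completable_def)
      then have "t \<in> ?U" "\<And>i. i \<in> ?U \<Longrightarrow> W i \<le> W t" using t by auto
      moreover from this have "W t \<le> D" using W_le by (auto simp: labelled_def)
      ultimately show ?thesis
        using greedy_inv_single[OF inv] g k kp by (auto simp: good_def)
    qed
    moreover have "den greedy_round s = s2"
      using km kp s s1 base by (simp add: greedy_round_def greedy_state_def base_def s1_def[symmetric]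
          t_def[symmetric] s2_def)
    ultimately show ?thesis using s2 lab_le k km by (simp add: greedy_state_def)
  next
    case kp: False
    define s3 where "s3 = den pick (upd ''cap'' 0 (D - W t) s2)"
    define u where "u = s3 ''t'' 0"
    define s4 where "s4 = upd ''lab'' u k s3"
    have "s3 ''lab'' = s2 ''lab''" by (simp add: s3_def pick_fr)
    with s2 have s3: "base s3" "s3 ''p'' 0 = Suc p" "s3 ''m'' 0 = Suc m"
      "s3 ''lab'' = (s ''lab'')(t := k)" "s3 ''k'' 0 = k"
      by (simp_all add: s3_def base_def pick_fr)
    then have s4: "base s4" "s4 ''p'' 0 = Suc p" "s4 ''m'' 0 = Suc m"
      "s4 ''lab'' = (s ''lab'')(t := k, u := k)"
      by (auto simp: s4_def base_def)
    have "greedy_inv n W D e p m (Suc k) ((s ''lab'')(t := k, u := k))" if g: "good e p m"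
    proof -
      have inv: "greedy_inv n W D e p m k (s ''lab'')" using s g km by (simp add: greedy_state_def)
      have "m - (k - 1 - p) = Suc (m - (k - p))" using km kp by linarith
      then have c: "completable W D e ?U 0 (Suc (m - (k - p)))"
        using inv kp by (simp add: greedy_inv_def)
      then have "?U \<noteq> {}" by (auto simp: completable_def elim: peel_pairE)
      then have tU: "t \<in> ?U" "\<And>i. i \<in> ?U \<Longrightarrow> W i \<le> W t" using t by auto
      then have tD: "W t \<le> D" using W_le by (auto simp: labelled_def)
      \<comment> \<open>A completion guarantees some fitting partner for \<open>t\<close>, so the
        second \<open>pick\<close> cannot return 0.\<close>
      from completable_pair_largest[OF c tU] obtain z where
        z: "z \<in> ?U - {t}" "W t + W z \<le> D" by blast
      let ?S = "{i \<in> labelled n (s2 ''lab'') 0. W i \<le> D - W t}"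
      \<comment> \<open>In \<open>s2\<close> the item \<open>t\<close> already carries the positive
        label \<open>k\<close>, which excludes it from the candidates. Since
        \<open>W t \<le> D\<close>, the truncated difference is the true remaining capacity.\<close>
      have S: "?S = {i \<in> ?U - {t}. W t + W i \<le> D}"
        unfolding s2(4) using k tD by (auto simp: labelled_def)
      have "u = 0 \<and> ?S = {} \<or> u \<in> ?S \<and> (\<forall>i\<in>?S. W i \<le> W u)"
        using pick_correct[of "upd ''cap'' 0 (D - W t) s2" n] s2(1) W0
        by (simp add: u_def s3_def base_def)
      then have "u \<in> ?U - {t}" "W t + W u \<le> D" "\<And>i. i \<in> ?U - {t} \<Longrightarrow> W t + W i \<le> D \<Longrightarrow> W i \<le> W u"
        using z unfolding S by auto
      then show ?thesis
        using greedy_inv_pair[OF inv _ _ _ tU] g km kp by (auto simp: good_def)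
    qed
    moreover have "den greedy_round s = s4"
    proof -
      have "s2 ''w'' = W" "s2 ''D'' 0 = D" using s2 by (auto simp: base_def)
      moreover have "s2 ''t'' 0 = t" by (simp add: s2_def t_def)
      ultimately show ?thesis
        using km kp s s1 s2 s3 base by (simp add: greedy_round_def greedy_state_def base_def
            s1_def[symmetric] t_def[symmetric] s2_def[symmetric] s3_def[symmetric] u_def[symmetric]
            s4_def[symmetric])
    qed
    ultimately show ?thesis using s4 lab_le k km by (simp add: greedy_state_def)
  qed
qed

lemma trial_correct:
  assumes s: "base s" "s ''e'' 0 = e" "s ''p'' 0 = Suc p" "s ''m'' 0 = Suc m"
  defines "lab \<equiv> den trial s ''lab''"
  shows "\<forall>i\<in>{1..n}. lab i \<in> {1..n}"
    "good e p m \<Longrightarrow> feasible_labelling n W D lab \<and>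
      labelling_cost n C lab = p * C 1 + m * C 2 + C (n - p - 2 * m)"
proof -
  define s1 where "s1 = den (LFor ''i'' (LAssign ''lab'' (scalar ''i'') (Lit 0))) s"
  have fr1: "s1 x = s x" if "x \<notin> {''i'', ''lab''}" for x
    unfolding s1_def using that by (intro den_frame) simp
  have lab1: "\<forall>i\<in>{1..n}. s1 ''lab'' i = 0"
    unfolding s1_def
    by (rule den_LForI[where N = n and I = "\<lambda>i u. \<forall>j\<in>{1..<i}. u ''lab'' j = 0"])
      (use s in \<open>auto simp: base_def less_Suc_eq\<close>)
  define s2 where "s2 = upd ''lab'' e n s1"
  have s2: "greedy_state e p m 1 s2"
  proof -
    have lab2: "s2 ''lab'' = (s1 ''lab'')(e := n)" by (simp add: s2_def)
    have "greedy_inv n W D e p m 1 (s2 ''lab'')" if "good e p m"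
      unfolding lab2 using lab1 that by (intro greedy_inv_init) (auto simp: good_def)
    moreover have "\<forall>i\<in>{1..n}. s2 ''lab'' i \<le> n" using lab1 by (simp add: lab2)
    moreover have "base s2" "s2 ''p'' 0 = Suc p" "s2 ''m'' 0 = Suc m"
      using s fr1 by (simp_all add: base_def s2_def)
    ultimately show ?thesis by (simp add: greedy_state_def)
  qed
  define s3 where "s3 = den (LFor ''k'' greedy_round) s2"
  have s3: "greedy_state e p m (Suc n) s3"
    unfolding s3_def
  proof (rule den_LForI[where N = n and I = "\<lambda>k u. greedy_state e p m k u"], goal_cases)
    case (3 k u)
    then have "greedy_state e p m k (upd ''k'' 0 k u)"
      by (simp add: greedy_state_def base_def)
    with 3 show ?case by (intro greedy_round_correct) auto
  qed (use s2 in \<open>auto simp: greedy_state_def base_def\<close>)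
  have lab: "\<forall>i\<in>{1..n}. lab i = (if s3 ''lab'' i = 0 then n else s3 ''lab'' i)"
  proof -
    have eq: "lab = den (LFor ''i'' (LIf (BLess (entry ''lab'' ''i'') (Lit 1))
        (LAssign ''lab'' (scalar ''i'') (scalar ''n'')) LSkip)) s3 ''lab''"
    proof -
      have "s1 ''e'' 0 = e" "s1 ''n'' 0 = n" using s fr1 by (simp_all add: base_def)
      then have "den (LAssign ''lab'' (scalar ''e'') (scalar ''n'')) s1 = s2" by (simp add: s2_def)
      then show ?thesis unfolding lab_def trial_def den.simps(3) s3_def s1_def by simp
    qed
    show ?thesis
      unfolding eq
    proof (rule den_LForI[where N = n and I = "\<lambda>i u. u ''n'' 0 = n \<and>
        (\<forall>j. u ''lab'' j = (if j \<in> {1..<i} \<and> s3 ''lab'' j = 0 then n else s3 ''lab'' j))"], goal_cases)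
      case 1
      then show ?case using s3 by (simp add: greedy_state_def base_def)
    next
      case 2
      then show ?case using s3 by (simp add: greedy_state_def base_def)
    next
      case (3 i u)
      then show ?case by (auto simp: less_Suc_eq)
    qed auto
  qed
  have le: "\<forall>i\<in>{1..n}. s3 ''lab'' i \<le> n" using s3 by (simp add: greedy_state_def)
  show "\<forall>i\<in>{1..n}. lab i \<in> {1..n}" using lab le n_pos by auto
  assume g: "good e p m"
  then have "p + 2 * m < n" by (simp add: good_def)
  moreover from this have "greedy_inv n W D e p m (Suc (p + m)) (s3 ''lab'')"
    using s3 g by (simp add: greedy_state_def min_def split: if_splits)
  ultimately show "feasible_labelling n W D lab \<and>
      labelling_cost n C lab = p * C 1 + m * C 2 + C (n - p - 2 * m)"
    using greedy_inv_final[of n W D e p m "s3 ''lab''" C lab] C0 lab by auto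
qed

lemma search_step:
  assumes s: "search_state S s" "s ''e'' 0 = e" "s ''p'' 0 = p" "s ''m'' 0 = m" "1 \<le> p" "1 \<le> m"
  shows "search_state (insert (e, p, m) S) (den (trial;; evaluate;; update) s)"
proof -
  define s1 where "s1 = den trial s"
  define s2 where "s2 = den evaluate s1"
  define s3 where "s3 = den update s2"
  let ?lab = "s1 ''lab''"
  have b: "base s" using s by (simp add: search_state_def)
  have b1: "base s1" unfolding s1_def using b by (rule base_den) (simp add: program_defs)
  have b2: "base s2" unfolding s2_def using b1 by (rule base_den) (simp add: program_defs)
  have b3: "base s3" unfolding s3_def using b2 by (rule base_den) (simp add: program_defs)
  have fr: "s2 ''bin'' = s ''bin''" "s2 ''best'' = s ''best''" "s2 ''lab'' = ?lab"
    unfolding s2_def s1_def using den_frame[of _ evaluate "den trial s"] den_frame[of _ trial s]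
    by (auto simp: program_defs)
  have t: "\<forall>i\<in>{1..n}. ?lab i \<in> {1..n}"
    "good e (p - 1) (m - 1) \<Longrightarrow> feasible_labelling n W D ?lab \<and>
      labelling_cost n C ?lab = (p - 1) * C 1 + (m - 1) * C 2 + C (n - (p - 1) - 2 * (m - 1))"
    using trial_correct[OF b s(2), of "p - 1" "m - 1"] s by (auto simp: s1_def)
  have ev: "s2 ''bad'' 0 = 0 \<longleftrightarrow> feasible_labelling n W D ?lab" "s2 ''cost'' 0 = labelling_cost n C ?lab"
    using evaluate_correct[OF b1] by (auto simp: s2_def)
  let ?better = "feasible_labelling n W D ?lab \<and> labelling_cost n C ?lab < s ''best'' 0"
  have s3: "if ?better then s3 ''best'' 0 = labelling_cost n C ?lab \<and> (\<forall>i\<in>{1..n}. s3 ''bin'' i = ?lab i)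
    else s3 = s2"
  proof (cases ?better)
    case True
    define s2' where "s2' = upd ''best'' 0 (s2 ''cost'' 0) s2"
    have eq: "s3 = den (LFor ''i'' (LAssign ''bin'' (scalar ''i'') (entry ''lab'' ''i''))) s2'"
      using True ev fr by (simp add: s3_def update_def s2'_def)
    have "s3 ''best'' 0 = labelling_cost n C ?lab \<and> (\<forall>i\<in>{1..n}. s3 ''bin'' i = ?lab i)"
      unfolding eq
      by (rule den_LForI[where N = n and I = "\<lambda>i u. u ''lab'' = ?lab \<and>
          u ''best'' 0 = labelling_cost n C ?lab \<and> (\<forall>j\<in>{1..<i}. u ''bin'' j = ?lab j)"])
        (use b2 fr ev in \<open>auto simp: base_def less_Suc_eq s2'_def\<close>)
    then show ?thesis using True by simp
  next
    case False
    then show ?thesis using ev fr by (auto simp: s3_def update_def)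
  qed
  have "search_state (insert (e, p, m) S) s3"
  proof (cases ?better)
    case True
    then have bin: "\<And>i. i \<in> {1..n} \<Longrightarrow> s3 ''bin'' i = ?lab i"
      and best: "s3 ''best'' 0 = labelling_cost n C ?lab" using s3 by auto
    \<comment> \<open>Since \<open>best\<close> decreases, the bounds for earlier guesses
      persist.\<close>
    have lt: "s3 ''best'' 0 < s ''best'' 0" using best True by simp
    have cong: "feasible_labelling n W D (s3 ''bin'') = feasible_labelling n W D ?lab"
      "labelling_cost n C (s3 ''bin'') = labelling_cost n C ?lab"
      using feasible_labelling_cong[OF bin] labelling_cost_cong[OF bin] by simp_all
    show ?thesis
      unfolding search_state_def cong
    proof (intro conjI)
      show "\<forall>(e', p', m')\<in>insert (e, p, m) S. good e' (p' - 1) (m' - 1) \<longrightarrow>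
        s3 ''best'' 0 \<le> (p' - 1) * C 1 + (m' - 1) * C 2 + C (n - (p' - 1) - 2 * (m' - 1))"
        using s(1) lt t(2) best unfolding search_state_def by fastforce
    qed (use True t(1) bin b3 best in auto)
  next
    case False
    then have "s3 ''bin'' = s ''bin''" "s3 ''best'' = s ''best''" using s3 fr by auto
    then show ?thesis using s(1) t(2) False b3 unfolding search_state_def by auto
  qed
  then show ?thesis by (simp add: s3_def s2_def s1_def)
qed

lemma search_state_upd: "search_state S s \<Longrightarrow> x \<in> {''e'', ''p'', ''m''} \<Longrightarrow> search_state S (upd x i v s)"
  by (auto simp: search_state_def base_def)

lemma search_body_frame:
  assumes "x \<in> {''e'', ''p'', ''m''}"
  shows "den (trial;; evaluate;; update) s x = s x"
  by (rule den_frame) (use assms in \<open>auto simp: program_defs\<close>)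

lemma search_body_frame_For:
  "den (LFor ''m'' (trial;; evaluate;; update)) s ''e'' = s ''e''"
  by (rule den_frame) (simp add: program_defs)

lemma search_correct:
  assumes "search_state {} s"
  shows "search_state ({1..n} \<times> {1..n} \<times> {1..n})
    (den (LFor ''e'' (LFor ''p'' (LFor ''m'' (trial;; evaluate;; update)))) s)"
proof -
  let ?body = "trial;; evaluate;; update"
  have m: "search_state (S \<union> {e} \<times> {p} \<times> {1..n}) (den (LFor ''m'' ?body) s) "
    if "search_state S s" "s ''e'' 0 = e" "s ''p'' 0 = p" "1 \<le> p" for S s e p
  proof (rule den_LForI[where N = n and I = "\<lambda>i u. search_state (S \<union> {e} \<times> {p} \<times> {1..<i}) u \<and>
      u ''e'' 0 = e \<and> u ''p'' 0 = p"], goal_cases)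
    case (3 i u)
    let ?u = "upd ''m'' 0 i u"
    have "search_state (S \<union> {e} \<times> {p} \<times> {1..<i}) ?u" using 3 by (intro search_state_upd) auto
    then have "search_state (insert (e, p, i) (S \<union> {e} \<times> {p} \<times> {1..<i})) (den ?body ?u)"
      using 3 that by (intro search_step) auto
    also have "insert (e, p, i) (S \<union> {e} \<times> {p} \<times> {1..<i}) = S \<union> {e} \<times> {p} \<times> {1..<Suc i}"
      using 3 by auto
    finally show ?case using 3 search_body_frame[of _ ?u] by (simp del: den.simps)
  next
    case (4 u)
    then have "search_state (S \<union> {e} \<times> {p} \<times> {1..<Suc n}) (upd ''m'' 0 (Suc n) u)"
      by (intro search_state_upd) auto
    then show ?case by (simp only: atLeastLessThanSuc_atLeastAtMost)
  qed (use that in \<open>auto simp: search_state_def base_def\<close>)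
  have p: "search_state (S \<union> {e} \<times> {1..n} \<times> {1..n}) (den (LFor ''p'' (LFor ''m'' ?body)) s) "
    if "search_state S s" "s ''e'' 0 = e" for S s e
  proof (rule den_LForI[where N = n and I = "\<lambda>i u. search_state (S \<union> {e} \<times> {1..<i} \<times> {1..n}) u \<and>
      u ''e'' 0 = e"], goal_cases)
    case (3 i u)
    let ?u = "upd ''p'' 0 i u"
    have "search_state (S \<union> {e} \<times> {1..<i} \<times> {1..n}) ?u" using 3 by (intro search_state_upd) auto
    then have "search_state (S \<union> {e} \<times> {1..<i} \<times> {1..n} \<union> {e} \<times> {i} \<times> {1..n})
        (den (LFor ''m'' ?body) ?u)"
      using 3 that by (intro m) auto
    also have "S \<union> {e} \<times> {1..<i} \<times> {1..n} \<union> {e} \<times> {i} \<times> {1..n} = S \<union> {e} \<times> {1..<Suc i} \<times> {1..n}"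
      using 3 by auto
    finally show ?case using 3 search_body_frame_For[of ?u] by (simp del: den.simps)
  next
    case (4 u)
    then have "search_state (S \<union> {e} \<times> {1..<Suc n} \<times> {1..n}) (upd ''p'' 0 (Suc n) u)"
      by (intro search_state_upd) auto
    then show ?case by (simp only: atLeastLessThanSuc_atLeastAtMost)
  qed (use that in \<open>auto simp: search_state_def base_def\<close>)
  show ?thesis
  proof (rule den_LForI[where N = n and I = "\<lambda>i u. search_state ({1..<i} \<times> {1..n} \<times> {1..n}) u"],
      goal_cases)
    case (3 i u)
    let ?u = "upd ''e'' 0 i u"
    have "search_state ({1..<i} \<times> {1..n} \<times> {1..n}) ?u" using 3 by (intro search_state_upd) auto
    then have "search_state ({1..<i} \<times> {1..n} \<times> {1..n} \<union> {i} \<times> {1..n} \<times> {1..n})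
        (den (LFor ''p'' (LFor ''m'' ?body)) ?u)"
      by (intro p) auto
    also have "{1..<i} \<times> {1..n} \<times> {1..n} \<union> {i} \<times> {1..n} \<times> {1..n} = {1..<Suc i} \<times> {1..n} \<times> {1..n}"
      using 3 by auto
    finally show ?case .
  next
    case (4 u)
    then have "search_state ({1..<Suc n} \<times> {1..n} \<times> {1..n}) (upd ''e'' 0 (Suc n) u)"
      by (intro search_state_upd) auto
    then show ?case by (simp only: atLeastLessThanSuc_atLeastAtMost)
  qed (use assms in \<open>auto simp: search_state_def base_def\<close>)
qed

end

end

section \<open>From rational to integral instances\<close>

lemma rat_den_pos: "0 < rat_den q"
  using quotient_of_denom_pos[of q] by (cases "quotient_of q") (simp add: rat_den_def)

lemma of_nat_rat_num:
  assumes "0 \<le> q"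
  shows "of_nat (rat_num q) = q * of_nat (rat_den q)"
proof -
  obtain a b where ab: "quotient_of q = (a, b)" by (cases "quotient_of q")
  then have b: "0 < b" and q: "q = of_int a / of_int b"
    using quotient_of_denom_pos quotient_of_div by auto
  then have "0 \<le> a" using assms by (simp add: zero_le_divide_iff)
  then show ?thesis using ab b q by (simp add: rat_num_def rat_den_def)
qed

lemma of_nat_scaled:
  assumes "finite A" "i \<in> A" "0 \<le> g i"
  defines "T \<equiv> (\<Prod>i\<in>A. rat_den (g i))"
  shows "of_nat (T div rat_den (g i) * rat_num (g i)) = of_nat T * g i"
proof -
  have "rat_den (g i) dvd T" unfolding T_def using assms by (intro dvd_prodI) auto
  then obtain r where r: "T = rat_den (g i) * r" by blast
  then have "of_nat (T div rat_den (g i) * rat_num (g i)) = (of_nat r * of_nat (rat_num (g i)) :: rat)"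
    using rat_den_pos[of "g i"] by simp
  then show ?thesis using of_nat_rat_num[OF assms(3)] r by simp
qed

lemma output_partition_labelled:
  "output_partition I t = labelled (num_items I) (t ''bin'') ` t ''bin'' ` {1..num_items I}"
  by (simp add: output_partition_def labelled_def)

lemma partition_on_labelled: "partition_on {1..n} (labelled n lab ` lab ` {1..n})"
  by (rule partition_onI) (auto simp: labelled_def disjnt_def)

text \<open>Distinct labels in use have distinct bins because these are nonempty; the other labels
  contribute \<open>g {}\<close>.\<close>

lemma sum_labelled:
  assumes "\<And>i. i \<in> {1..n} \<Longrightarrow> lab i \<in> {1..n}" "g {} = (0 :: 'a :: comm_monoid_add)"
  shows "(\<Sum>B\<in>labelled n lab ` lab ` {1..n}. g B) = (\<Sum>k = 1..n. g (labelled n lab k))"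
proof -
  have inj: "inj_on (labelled n lab) (lab ` {1..n})"
  proof (rule inj_onI)
    fix a b assume "a \<in> lab ` {1..n}" "labelled n lab a = labelled n lab b"
    then obtain i where "i \<in> labelled n lab a" "labelled n lab a = labelled n lab b"
      by (auto simp: labelled_def)
    then have "i \<in> labelled n lab a" "i \<in> labelled n lab b" by simp_all
    then show "a = b" by (simp add: labelled_def)
  qed
  have "(\<Sum>B\<in>labelled n lab ` lab ` {1..n}. g B) = (\<Sum>k\<in>lab ` {1..n}. g (labelled n lab k))"
    using sum.reindex[OF inj, of g] by (simp add: comp_def)
  also have "\<dots> = (\<Sum>k = 1..n. g (labelled n lab k))"
  proof (rule sum.mono_neutral_left)
    show "\<forall>k\<in>{1..n} - lab ` {1..n}. g (labelled n lab k) = 0"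
    proof
      fix k assume "k \<in> {1..n} - lab ` {1..n}"
      then have "labelled n lab k = {}" by (auto simp: labelled_def)
      then show "g (labelled n lab k) = 0" using assms(2) by simp
    qed
    show "lab ` {1..n} \<subseteq> {1..n}" using assms(1) by blast
  qed simp
  finally show ?thesis .
qed

text \<open>The form in which \<open>k = 2\<close> enters the proof: \<open>F(2) \<le> F(j)\<close>,
  cross-multiplied so that it carries over to integers.\<close>

lemma density_two:
  assumes "gcbp_instance I" "min_density_index I = 2"
  shows "2 \<le> num_items I"
    "\<And>j. j \<in> {1..num_items I} \<Longrightarrow> bin_cost I 2 * of_nat j \<le> 2 * bin_cost I j"
proof -
  let ?n = "num_items I"
  have n: "1 \<le> ?n" using assms(1) by (simp add: gcbp_instance_def)
  have fin: "finite (min_density_set I)"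
    by (rule finite_subset[of _ "{1..?n}"]) (auto simp: min_density_set_def is_arg_min_def)
  \<comment> \<open>Shows that the set is nonempty, so that \<open>Min\<close> is one of its
    elements.\<close>
  have "arg_min_on (density I) {1..?n} \<in> min_density_set I"
    unfolding min_density_set_def is_arg_min_def
    using arg_min_if_finite[of "{1..?n}" "density I"] n by auto
  then have "2 \<in> min_density_set I"
    using Min_in[OF fin] assms(2) by (auto simp: min_density_index_def)
  then have 2: "2 \<le> ?n" "\<And>j. j \<in> {1..?n} \<Longrightarrow> density I 2 \<le> density I j"
    by (auto simp: min_density_set_def is_arg_min_def not_less)
  show "2 \<le> ?n" by (rule 2(1))
  fix j assume j: "j \<in> {1..?n}"
  then show "bin_cost I 2 * of_nat j \<le> 2 * bin_cost I j"
    using 2(2)[OF j] by (simp add: density_def field_simps)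
qed

section \<open>Optimality of the output and the final time bound\<close>

lemma solver_correct:
  assumes I: "gcbp_instance I" "min_density_index I = 2"
  shows "optimal I (output_partition I (den solver (input_state I)))"
proof -
  define n where "n = num_items I"
  define s where "s = input_state I"
  define D where "D = (\<Prod>i = 1..n. rat_den (item_size I i))"
  define E where "E = (\<Prod>j = 1..n. rat_den (bin_cost I j))"
  \<comment> \<open>\<open>W\<close> and \<open>C\<close> are the exact contents of the arrays
    \<open>w\<close> and \<open>c\<close> after scaling, including the zeros outside of
    \<open>1..n\<close>.\<close>
  define W where "W = (\<lambda>i. if i \<in> {1..n} then D div rat_den (item_size I i) * rat_num (item_size I i) else 0)"
  define C where "C = (\<lambda>j. if j \<in> {1..n} then E div rat_den (bin_cost I j) * rat_num (bin_cost I j) else 0)"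
  have n: "1 \<le> n" and size: "\<And>i. i \<in> {1..n} \<Longrightarrow> 0 \<le> item_size I i \<and> item_size I i \<le> 1"
    and cost: "\<And>j. j \<in> {0..n} \<Longrightarrow> 0 \<le> bin_cost I j" "bin_cost I 0 = 0" "bin_cost I 1 = 1"
    using I(1) by (auto simp: gcbp_instance_def n_def)
  have D: "0 < D" and E: "0 < E"
    by (auto simp: D_def E_def rat_den_pos intro!: prod_pos)
  have W: "(of_nat (W i) :: rat) = of_nat D * item_size I i" if "i \<in> {1..n}" for i
    using of_nat_scaled[of "{1..n}" i "item_size I"] size[OF that] that by (simp add: W_def D_def)
  have C: "(of_nat (C j) :: rat) = of_nat E * bin_cost I j" if "j \<in> {0..n}" for j
    using of_nat_scaled[of "{1..n}" j "bin_cost I"] cost that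
    by (cases "j = 0") (simp_all add: C_def E_def)
  have W_le: "W i \<le> D" if "i \<in> {1..n}" for i
  proof -
    have "(of_nat (W i) :: rat) \<le> of_nat D * 1" unfolding W[OF that]
      using size[OF that] by (intro mult_left_mono) auto
    then show ?thesis by simp
  qed
  have W0: "W 0 = 0" and C0: "C 0 = 0" by (simp_all add: W_def C_def)
  have C1: "C 1 = E"
  proof -
    have "(of_nat (C 1) :: rat) = of_nat E" using C[of 1] n cost(3) by simp
    then show ?thesis by simp
  qed
  have C2: "C 2 * j \<le> 2 * C j" if "1 \<le> j" "j \<le> n" for j
  proof -
    have "(of_nat (C 2 * j) :: rat) = of_nat E * (bin_cost I 2 * of_nat j)"
      using C[of 2] density_two(1)[OF I] by (simp add: n_def)
    also have "\<dots> \<le> of_nat E * (2 * bin_cost I j)"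
      using density_two(2)[OF I, of j] that by (intro mult_left_mono) (auto simp: n_def)
    also have "\<dots> = of_nat (2 * C j)" using C[of j] that by simp
    finally show ?thesis by (simp only: of_nat_le_iff)
  qed
  have sum_W: "sum W B \<le> D \<longleftrightarrow> sum (item_size I) B \<le> 1" if "B \<subseteq> {1..n}" for B
  proof -
    have "(of_nat (sum W B) :: rat) = (\<Sum>i\<in>B. of_nat D * item_size I i)"
      unfolding of_nat_sum using that W by (intro sum.cong) auto
    then have "sum W B \<le> D \<longleftrightarrow> of_nat D * sum (item_size I) B \<le> of_nat D * (1 :: rat)"
      by (simp add: sum_distrib_left flip: of_nat_le_iff[where 'a = rat])
    also have "\<dots> \<longleftrightarrow> sum (item_size I) B \<le> 1" using D by (subst mult_le_cancel_left_pos) auto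
    finally show ?thesis .
  qed
  have sum_C: "(of_nat (\<Sum>B\<in>P. C (card B)) :: rat) = of_nat E * total_cost I P"
    if "\<And>B. B \<in> P \<Longrightarrow> B \<subseteq> {1..n}" for P
  proof -
    have "card B \<in> {0..n}" if "B \<in> P" for B
      using card_mono[of "{1..n}" B] \<open>\<And>B. B \<in> P \<Longrightarrow> B \<subseteq> {1..n}\<close>[OF that] by simp
    then show ?thesis unfolding total_cost_def of_nat_sum sum_distrib_left
      using C by (intro sum.cong) auto
  qed
  define s1 where "s1 = den (scale ''D'' ''w'' ''s_num'' ''s_den'') s"
  define s2 where "s2 = den (scale ''E'' ''c'' ''f_num'' ''f_den'') s1"
  define s3 where "s3 = upd ''best'' 0 (E * n) s2"
  define s4 where "s4 = den (LFor ''i'' (LAssign ''bin'' (scalar ''i'') (scalar ''i''))) s3"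
  let ?search = "LFor ''e'' (LFor ''p'' (LFor ''m'' (trial;; evaluate;; update)))"
  have s: "s ''n'' 0 = n" "s ''w'' i = 0" "s ''c'' i = 0" for i
    by (simp_all add: s_def input_state_def n_def)
  have s_in: "s ''s_num'' i = rat_num (item_size I i)" "s ''s_den'' i = rat_den (item_size I i)"
    "s ''f_num'' i = rat_num (bin_cost I i)" "s ''f_den'' i = rat_den (bin_cost I i)"
    if "i \<in> {1..n}" for i
    using that by (auto simp: s_def input_state_def n_def)
  have s1: "s1 ''D'' 0 = D" "s1 ''w'' = W"
    using scale_correct[of "''D''" "''w''" "''s_num''" "''s_den''" s n] s s_in
    by (auto simp: s1_def D_def W_def fun_eq_iff)
  have fr1: "s1 x = s x" if "x \<notin> {''D'', ''w'', ''i''}" for x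
    unfolding s1_def using that by (intro den_frame) (simp add: scale_def)
  have s2: "s2 ''E'' 0 = E" "s2 ''c'' = C"
    using scale_correct[of "''E''" "''c''" "''f_num''" "''f_den''" s1 n] s s_in fr1
    by (auto simp: s2_def E_def C_def fun_eq_iff)
  have fr2: "s2 x = s1 x" if "x \<notin> {''E'', ''c'', ''i''}" for x
    unfolding s2_def using that by (intro den_frame) (simp add: scale_def)
  have fr4: "s4 x = s3 x" if "x \<notin> {''bin'', ''i''}" for x
    unfolding s4_def using that by (intro den_frame) simp
  have s3n: "s3 ''n'' 0 = n" using s fr1 fr2 by (simp add: s3_def)
  have bin4: "s4 ''bin'' i = i" if "i \<in> {1..n}" for i
  proof -
    have "\<forall>i\<in>{1..n}. s4 ''bin'' i = i"
      unfolding s4_def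
      by (rule den_LForI[where N = n and I = "\<lambda>i u. \<forall>j\<in>{1..<i}. u ''bin'' j = j"])
        (use s3n in \<open>auto simp: less_Suc_eq\<close>)
    then show ?thesis using that by blast
  qed
  have solver: "den solver s = den ?search s4"
  proof -
    have "den (LSet ''best'' (Mul (scalar ''E'') (scalar ''n''))) s2 = s3"
      using s s2 fr1 fr2 by (simp add: s3_def)
    then show ?thesis
      unfolding solver_def den.simps(3) s4_def s2_def s1_def by (simp del: den.simps)
  qed
  have "search_state n D W C {} s4"
  proof -
    have lab: "labelled n (s4 ''bin'') k = {k}" if "k \<in> {1..n}" for k
      unfolding labelled_def using bin4 that by auto
    have "base n D W C s4"
      using s s1 s2 fr1 fr2 fr4 by (simp add: base_def s3_def)
    moreover have "feasible_labelling n W D (s4 ''bin'')"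
      unfolding feasible_labelling_def using lab W_le by simp
    moreover have "s4 ''best'' 0 = labelling_cost n C (s4 ''bin'')"
    proof -
      have "labelling_cost n C (s4 ''bin'') = (\<Sum>k = 1..n. C 1)"
        unfolding labelling_cost_def using lab by (intro sum.cong) auto
      then show ?thesis using C1 fr4 by (simp add: s3_def mult.commute)
    qed
    ultimately show ?thesis using bin4 by (simp add: search_state_def)
  qed
  then have fin: "search_state n D W C ({1..n} \<times> {1..n} \<times> {1..n}) (den solver s)"
    unfolding solver by (intro search_correct n W0 W_le C0)
  define t where "t = den solver s"
  define lab where "lab = t ''bin''"
  let ?P = "output_partition I t"
  have P: "?P = labelled n lab ` lab ` {1..n}" by (simp add: output_partition_labelled n_def lab_def)
  have range: "\<And>i. i \<in> {1..n} \<Longrightarrow> lab i \<in> {1..n}" and feas: "feasible_labelling n W D lab"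
    and best: "t ''best'' 0 = labelling_cost n C lab"
    and opt: "\<And>e p m. e \<in> {1..n} \<Longrightarrow> p \<in> {1..n} \<Longrightarrow> m \<in> {1..n} \<Longrightarrow> good n D W e (p - 1) (m - 1) \<Longrightarrow>
      t ''best'' 0 \<le> (p - 1) * C 1 + (m - 1) * C 2 + C (n - (p - 1) - 2 * (m - 1))"
    using fin unfolding search_state_def t_def lab_def by auto
  have sub: "B \<subseteq> {1..n}" if "B \<in> ?P" for B using that unfolding P by (auto simp: labelled_def)
  have "feasible I ?P"
    unfolding feasible_def
  proof (intro conjI ballI)
    show "partition_on {1..num_items I} ?P" unfolding P n_def[symmetric] by (rule partition_on_labelled)
    fix B assume B: "B \<in> ?P"
    then have "sum W B \<le> D" using feas range unfolding P feasible_labelling_def by blast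
    then show "sum (item_size I) B \<le> 1" using sum_W[OF sub[OF B]] by simp
  qed
  moreover have "\<not> total_cost I Q < total_cost I ?P" if Q: "feasible I Q" for Q
  proof -
    have Q': "partition_on {1..n} Q" "\<And>B. B \<in> Q \<Longrightarrow> sum (item_size I) B \<le> 1"
      using Q by (auto simp: feasible_def n_def)
    have subQ: "B \<subseteq> {1..n}" if "B \<in> Q" for B using that Q'(1) by (auto simp: partition_on_def)
    have "sum W B \<le> D" if "B \<in> Q" for B using sum_W[OF subQ[OF that]] Q'(2)[OF that] by simp
    \<comment> \<open>The competitor \<open>Q\<close> yields a good guess that costs no more. The
      search has tried it: \<open>p + 2 * m < n\<close> puts \<open>Suc p\<close> and
      \<open>Suc m\<close> into \<open>1..n\<close>.\<close>
    from exists_completable[OF n W_le C0 C2 Q'(1) this] obtain e p m where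
      epm: "e \<in> {1..n}" "p + 2 * m < n" "completable W D e ({1..n} - {e}) p m"
        "p * C 1 + m * C 2 + C (n - p - 2 * m) \<le> (\<Sum>B\<in>Q. C (card B))" by blast
    then have "good n D W e p m" by (simp add: good_def)
    then have "t ''best'' 0 \<le> p * C 1 + m * C 2 + C (n - p - 2 * m)"
      using opt[of e "Suc p" "Suc m"] epm by simp
    then have "labelling_cost n C lab \<le> (\<Sum>B\<in>Q. C (card B))" using epm(4) best by simp
    moreover have "labelling_cost n C lab = (\<Sum>B\<in>?P. C (card B))"
      unfolding labelling_cost_def P
      using sum_labelled[of n lab "\<lambda>B. C (card B)"] range C0 by simp
    ultimately have "(of_nat (\<Sum>B\<in>?P. C (card B)) :: rat) \<le> of_nat (\<Sum>B\<in>Q. C (card B))"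
      by (simp only: of_nat_le_iff)
    then have "of_nat E * total_cost I ?P \<le> of_nat E * total_cost I Q"
      using sum_C[of ?P] sum_C[of Q] sub subQ by simp
    then show ?thesis using E by (simp add: mult_le_cancel_left_pos)
  qed
  ultimately show ?thesis
    unfolding optimal_def is_arg_min_def t_def s_def by blast
qed

text \<open>Every item contributes at least one bit to the input, so the number of items itself, and
  not just its bit length, is at most \<open>L\<close>. This is what makes loops over
  \<open>1..n\<close> polynomial.\<close>

lemma input_state_bounds:
  fixes I :: gcbp
  defines "L \<equiv> input_length I"
  shows "bounded_by L (input_state I)" "num_items I \<le> L" "1 \<le> L"
proof -
  let ?n = "num_items I"
  let ?S = "\<Sum>i = 1..?n. rat_length (item_size I i)" and ?F = "\<Sum>j = 0..?n. rat_length (bin_cost I j)"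
  have L: "L = bit_length ?n + ?S + ?F" by (simp add: L_def input_length_def)
  have le: "x < 2 ^ L" if "bit_length x \<le> L" for x
    using less_two_power_bit_length[of x] that
    by (rule less_le_trans[OF _ power_increasing]) simp
  have size: "rat_length (item_size I i) \<le> L" if "i \<in> {1..?n}" for i
    using member_le_sum[of i "{1..?n}" "\<lambda>i. rat_length (item_size I i)"] that L by simp
  have cost: "rat_length (bin_cost I j) \<le> L" if "j \<in> {0..?n}" for j
    using member_le_sum[of j "{0..?n}" "\<lambda>j. rat_length (bin_cost I j)"] that L by simp
  have "?n < 2 ^ L" using L by (intro le) simp
  moreover have "rat_num (item_size I i) < 2 ^ L" "rat_den (item_size I i) < 2 ^ L" if "i \<in> {1..?n}" for i
    using size[OF that] by (intro le; simp add: rat_length_def)+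
  moreover have "rat_num (bin_cost I j) < 2 ^ L" "rat_den (bin_cost I j) < 2 ^ L" if "j \<in> {0..?n}" for j
    using cost[OF that] by (intro le; simp add: rat_length_def)+
  ultimately show "bounded_by L (input_state I)"
    unfolding bounded_by_def input_state_def by simp
  have "?n = (\<Sum>i = 1..?n. 1)" by simp
  also have "\<dots> \<le> ?S" using bit_length_ge_1 by (intro sum_mono) (simp add: rat_length_def trans_le_add1)
  finally show "?n \<le> L" using L by simp
  show "1 \<le> L" using L bit_length_ge_1[of ?n] by simp
qed

theorem theorem2:
  "\<exists>c. solves_in_poly_time c (\<lambda>I. min_density_index I = 2)"
proof -
  obtain p q where pq: "\<And>s M L. bounded_by M s \<Longrightarrow> inputs_bounded_by L s \<Longrightarrow> 1 \<le> L \<Longrightarrow>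
     L \<le> M \<Longrightarrow> s ''n'' 0 \<le> L \<Longrightarrow>
     (\<exists>\<tau>\<le>poly p L * (M + poly q L). exec (compile solver) s \<tau> (den solver s)) \<and>
     bounded_by (M + poly q L) (den solver s)"
    by (rule poly_timeE[OF wf_prog_poly_time[OF wf_solver]]) blast
  have "solves_in_poly_time (compile solver) (\<lambda>I. min_density_index I = 2)"
    unfolding solves_in_poly_time_def
  \<comment> \<open>Initially the memory holds nothing but the input, so the length bound
    \<open>M\<close> starts out as \<open>L\<close>.\<close>
  proof (intro exI[of _ "p * ([:0, 1:] + q)"] allI impI)
    fix I assume I: "gcbp_instance I \<and> min_density_index I = 2"
    let ?L = "input_length I" and ?s = "input_state I"
    have b: "bounded_by ?L ?s" by (rule input_state_bounds)
    then have "inputs_bounded_by ?L ?s" by (simp add: bounded_by_def inputs_bounded_by_def)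
    moreover have "?s ''n'' 0 \<le> ?L" using input_state_bounds(2)[of I] by (simp add: input_state_def)
    ultimately obtain \<tau> where "\<tau> \<le> poly p ?L * (?L + poly q ?L)" "exec (compile solver) ?s \<tau> (den solver ?s)"
      using pq[OF b] input_state_bounds(3)[of I] by blast
    then show "\<exists>\<tau> t. exec (compile solver) ?s \<tau> t \<and> \<tau> \<le> poly (p * ([:0, 1:] + q)) ?L \<and>
        optimal I (output_partition I t)"
      using solver_correct I by (intro exI[of _ \<tau>] exI[of _ "den solver ?s"]) auto
  qed
  then show ?thesis by blast
qed

end
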